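(* Let $\xi$ be a quadratic irrational that is a BR-number. Then: (1) the set of records of the deterministic random walk $S_n(2\xi)$ is $\xi$-Ostrowski automatic; and (2) the sequence of records of $S_n(2\xi)$, listed in increasing order, satisfies a system of linear recurrence relations.
   Context: Deterministic random walk: for real $\eta$ and $n\ge0$, $S_n(\eta)=\sum_{j=1}^n(-1)^{\lfloor j\eta\rfloor}$, with $S_0(\eta)=0$. An index $r\ge0$ is a record of $S_n(\eta)$ if $S_n(\eta)\ne S_r(\eta)$ for all $0\le n<r$ (so $0$ is a record). Let $\xi>0$ be irrational with regular continued fraction $\xi=[a_0;a_1,a_2,\dots]$ and convergents $p_n/q_n=[a_0;a_1,\dots,a_n]$ (so $q_0=1$, $q_1=a_1$, $q_{n+1}=a_{n+1}q_n+q_{n-1}$). $\xi$ is a BR-number if $q_{2n+1}$ is even for all $n\ge0$; equivalently, if $a_{2n+1}$ is even for all $n\ge0$. $\xi$-Ostrowski numeration: every integer $N\ge0$ is uniquely $N=\sum_{0\le i\le j}b_iq_i$ with integer digits satisfying (a) $0\le b_0<a_1$; (b) $0\le b_i\le a_{i+1}$ for $i\ge1$; (c) for $i\ge1$, if $b_i=a_{i+1}$ then $b_{i-1}=0$. A set (or increasing sequence) of non-negative integers is $\xi$-Ostrowski automatic if there is a deterministic finite-state automaton that reads the digits of the $\xi$-Ostrowski representation of a number $N$ and accepts if and only if $N$ belongs to the set. (For quadratic $\xi$ the partial quotients are bounded, so the digit alphabet is finite, and reading most significant or least significant digit first gives equivalent notions.) System of linear recurrence relations: a sequence $(t_n)$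 satisfies such a system if there are integers $p\ge1$, $d\ge1$, and for each residue $i\in\{0,\dots,p-1\}$ integer coefficients $c_{i,1},\dots,c_{i,d}$ and an integer constant $e_i$, such that for all sufficiently large $n$, $t_{pn+i}=e_i+\sum_{l=1}^d c_{i,l}\,t_{pn+i-l}$. (Example of the form intended: $t_{4n+1}=2t_{4n}+t_{4n-1}+1$, $t_{4n+2}=t_{4n+1}+2t_{4n}+1$, $t_{4n+3}=t_{4n+2}+2t_{4n}+1$, $t_{4n+4}=2t_{4n+3}+t_{4n}+1$.) *)

theory Defs
  imports Complex_Main "HOL-Library.Infinite_Set"
begin

definition walk :: "real \<Rightarrow> nat \<Rightarrow> real" where
  "walk \<eta> n = (\<Sum>j = 1..n. (-1) powi \<lfloor>real j * \<eta>\<rfloor>)"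

definition records :: "(nat \<Rightarrow> 'a) \<Rightarrow> nat set" where
  "records s = {r. \<forall>n<r. s n \<noteq> s r}"


primrec complete_quotient :: "real \<Rightarrow> nat \<Rightarrow> real" where
  "complete_quotient \<xi> 0 = \<xi>"
| "complete_quotient \<xi> (Suc n) = 1 / frac (complete_quotient \<xi> n)"

(* Used only for irrational \<xi> > 0, where all floors are non-negative, so that nat
   truncates nothing, and no complete quotient has fractional part 0. *)
definition partial_quotient :: "real \<Rightarrow> nat \<Rightarrow> nat" where
  "partial_quotient \<xi> n = nat \<lfloor>complete_quotient \<xi> n\<rfloor>"

fun convergent_denom :: "real \<Rightarrow> nat \<Rightarrow> nat" where
  "convergent_denom \<xi> 0 = 1"
| "convergent_denom \<xi> (Suc 0) = partial_quotient \<xi> 1"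
| "convergent_denom \<xi> (Suc (Suc n)) =
     partial_quotient \<xi> (Suc (Suc n)) * convergent_denom \<xi> (Suc n) + convergent_denom \<xi> n"

definition BR_number :: "real \<Rightarrow> bool" where
  "BR_number \<xi> \<longleftrightarrow> \<xi> > 0 \<and> \<xi> \<notin> \<rat> \<and> (\<forall>n. even (convergent_denom \<xi> (2 * n + 1)))"

definition quadratic_irrational :: "real \<Rightarrow> bool" where
  "quadratic_irrational \<xi> \<longleftrightarrow> \<xi> \<notin> \<rat> \<and>
     (\<exists>a b c :: int. a \<noteq> 0 \<and> of_int a * \<xi>\<^sup>2 + of_int b * \<xi> + of_int c = 0)"


(* Digits are listed least significant first, so that b ! i is the multiplier of the
   i-th denominator. The leading digit is non-zero, and 0 is represented by the empty list. *)
definition is_ostrowski_rep :: "real \<Rightarrow> nat \<Rightarrow> nat list \<Rightarrow> bool" where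
  "is_ostrowski_rep \<xi> N b \<longleftrightarrow>
     N = (\<Sum>i<length b. b ! i * convergent_denom \<xi> i) \<and>
     (b \<noteq> [] \<longrightarrow> last b \<noteq> 0) \<and>
     (b \<noteq> [] \<longrightarrow> b ! 0 < partial_quotient \<xi> 1) \<and>
     (\<forall>i. 1 \<le> i \<and> i < length b \<longrightarrow> b ! i \<le> partial_quotient \<xi> (i + 1)) \<and>
     (\<forall>i. 1 \<le> i \<and> i < length b \<and> b ! i = partial_quotient \<xi> (i + 1) \<longrightarrow> b ! (i - 1) = 0)"

definition ostrowski_rep :: "real \<Rightarrow> nat \<Rightarrow> nat list" where
  "ostrowski_rep \<xi> N = (THE b. is_ostrowski_rep \<xi> N b)"


record ('s, 'a) dfa =
  dfa_states :: "'s set"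
  dfa_alphabet :: "'a set"
  dfa_init :: 's
  dfa_trans :: "'s \<Rightarrow> 'a \<Rightarrow> 's"
  dfa_accepting :: "'s set"

definition is_dfa :: "('s, 'a) dfa \<Rightarrow> bool" where
  "is_dfa M \<longleftrightarrow> finite (dfa_states M) \<and> finite (dfa_alphabet M) \<and>
     dfa_init M \<in> dfa_states M \<and> dfa_accepting M \<subseteq> dfa_states M \<and>
     (\<forall>s\<in>dfa_states M. \<forall>a\<in>dfa_alphabet M. dfa_trans M s a \<in> dfa_states M)"

definition dfa_accepts :: "('s, 'a) dfa \<Rightarrow> 'a list \<Rightarrow> bool" where
  "dfa_accepts M w \<longleftrightarrow>
     w \<in> lists (dfa_alphabet M) \<and> foldl (dfa_trans M) (dfa_init M) w \<in> dfa_accepting M"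

(* The automaton reads the most significant digit first. Taking the states to be
   natural numbers loses no generality, since the state set is finite. *)
definition ostrowski_automatic :: "real \<Rightarrow> nat set \<Rightarrow> bool" where
  "ostrowski_automatic \<xi> A \<longleftrightarrow>
     (\<exists>M :: (nat, nat) dfa. is_dfa M \<and>
        (\<forall>N. rev (ostrowski_rep \<xi> N) \<in> lists (dfa_alphabet M) \<and>
             (dfa_accepts M (rev (ostrowski_rep \<xi> N)) \<longleftrightarrow> N \<in> A)))"


(* For large n the index p * n + i is at least d, so the subtraction does not truncate. *)
definition satisfies_linear_recurrence_system :: "(nat \<Rightarrow> int) \<Rightarrow> bool" where
  "satisfies_linear_recurrence_system t \<longleftrightarrow>
     (\<exists>(p::nat) (d::nat) (c :: nat \<Rightarrow> nat \<Rightarrow> int) (e :: nat \<Rightarrow> int).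
        p \<ge> 1 \<and> d \<ge> 1 \<and>
        (\<forall>i<p. \<forall>\<^sub>F n in sequentially.
           t (p * n + i) = e i + (\<Sum>l = 1..d. c i l * t (p * n + i - l))))"

end

theory Submission
  imports Defs
begin

text \<open>
  Let \<open>a n\<close> be the partial quotients and \<open>p n / q n\<close> the convergents of \<open>\<xi>\<close>, and let \<open>f j = \<plusminus>1\<close> be the \<open>j\<close>-th step of the walk
  \<open>W\<close>; its sign is given by the parity of the integer part of \<open>2j\<xi>\<close>. For a BR-number every
  \<open>q (2m+1)\<close> is even, and the determinant of consecutive convergents then makes \<open>q (2m)\<close> and
  \<open>p (2m+1)\<close> odd. The records turn out to be \<open>0\<close> and the numbers
  \<open>q (2m-1) / 2 + c * q (2m)\<close> with \<open>1 \<le> c \<le> a (2m+1) / 2\<close>,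
  where \<open>q (-1) = 0\<close>; the walk never becomes negative, and these are the times at which it
  first reaches \<open>1, 2, 3, \<dots>\<close>.

  The reason is that the walk nearly repeats itself along the convergents. Shifting \<open>j\<close> by
  \<open>q n\<close> moves \<open>2j\<xi>\<close>, up to an even integer, by \<open>\<plusminus>2 * D n\<close>, where \<open>D n = \<bar>q n * \<xi> - p n\<bar>\<close> is
  small. This changes
  the step only if an integer lies in between, which would be an unusually good approximation of
  an integer by an even multiple of \<open>\<xi>\<close>. Expressing such a point in the lattice basis of two
  consecutive convergents and using the parities, one sees that none exists in the relevant
  range (\<open>no_even_multiple_below_integer\<close>, \<open>no_even_multiple_above_integer\<close>). Hence a shift by
  \<open>q (2m)\<close> adds \<open>1\<close> to the walk, a shift by \<open>q (2m+1)\<close> adds \<open>0\<close>, and within the first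
  \<open>q (2m+1)\<close> steps the second half is a mirror image of the first, one unit higher
  (\<open>walk_shift_even\<close>, \<open>walk_shift_odd\<close>, \<open>walk_second_half\<close>). An induction on \<open>m\<close> over these three
  rules bounds the walk on each level and yields the records (\<open>walk_before_record\<close>,
  \<open>first_hit_level\<close>, \<open>records_eq_range_first_hit\<close>).

  Because \<open>q (2m+1) - q (2m-1) = a (2m+1) * q (2m)\<close>, the number \<open>q (2m-1) / 2\<close> telescopes, and the
  Ostrowski digits of a record are \<open>a 1 / 2, 0, a 3 / 2, 0, \<dots>, 0, c\<close> from the least significant
  one upwards. By Lagrange's theorem the partial quotients of a quadratic irrational are eventually
  periodic. Thus the language of these digit words has only finitely many left quotients and is
  regular by the Myhill--Nerode argument, and the denominators, hence the records, satisfy a linear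
  recurrence with constant coefficients: the trace and determinant of the product of the
  elementary matrices over one period.
\<close>

declare complete_quotient.simps(2) [simp del]

section \<open>Convergents of an irrational number\<close>

fun convergent_num :: "real \<Rightarrow> nat \<Rightarrow> int" where
  "convergent_num \<xi> 0 = \<lfloor>\<xi>\<rfloor>"
| "convergent_num \<xi> (Suc 0) = \<lfloor>\<xi>\<rfloor> * int (partial_quotient \<xi> 1) + 1"
| "convergent_num \<xi> (Suc (Suc n)) =
     int (partial_quotient \<xi> (Suc (Suc n))) * convergent_num \<xi> (Suc n) + convergent_num \<xi> n"

text \<open>The distance \<open>\<bar>q n * \<xi> - p n\<bar>\<close>; as a product it is visibly positive and decreasing. The
alternating sign is restored in \<open>convergent_error\<close>.\<close>

definition approx_error :: "real \<Rightarrow> nat \<Rightarrow> real" where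
  "approx_error \<xi> n = (\<Prod>i\<le>n. frac (complete_quotient \<xi> i))"

locale irrational_number =
  fixes \<xi> :: real
  assumes irrational: "\<xi> \<notin> \<rat>"
begin

abbreviation t :: "nat \<Rightarrow> real" where "t \<equiv> complete_quotient \<xi>"
abbreviation a :: "nat \<Rightarrow> nat" where "a \<equiv> partial_quotient \<xi>"
abbreviation q :: "nat \<Rightarrow> nat" where "q \<equiv> convergent_denom \<xi>"
abbreviation p :: "nat \<Rightarrow> int" where "p \<equiv> convergent_num \<xi>"
abbreviation D :: "nat \<Rightarrow> real" where "D \<equiv> approx_error \<xi>"

lemma complete_quotient_irrational: "t n \<notin> \<rat>"
proof (induction n)
  case 0
  then show ?case using irrational by simp
next
  case (Suc n)
  show ?case
  proof
    assume "t (Suc n) \<in> \<rat>"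
    then have "1 / t (Suc n) \<in> \<rat>" by (intro Rats_divide) auto
    then have "frac (t n) + of_int \<lfloor>t n\<rfloor> \<in> \<rat>"
      by (intro Rats_add) (auto simp: complete_quotient.simps(2))
    then show False using Suc by (simp add: frac_def)
  qed
qed

lemma frac_complete_quotient_pos: "0 < frac (t n)"
  using complete_quotient_irrational[of n] Ints_subset_Rats by auto

lemma complete_quotient_gt_1: "1 < t (Suc n)"
  using frac_complete_quotient_pos[of n] frac_lt_1[of "t n"] by (simp add: complete_quotient.simps(2))

lemma partial_quotient_eq: "real (a (Suc n)) = t (Suc n) - frac (t (Suc n))"
proof -
  have "\<lfloor>t (Suc n)\<rfloor> \<ge> 0" using complete_quotient_gt_1[of n] by linarith
  then show ?thesis by (simp add: partial_quotient_def frac_def)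
qed

lemma partial_quotient_pos: "1 \<le> a (Suc n)"
proof -
  have "1 \<le> \<lfloor>t (Suc n)\<rfloor>" using complete_quotient_gt_1[of n] by linarith
  then show ?thesis unfolding partial_quotient_def by linarith
qed

lemma approx_error_Suc: "D (Suc n) = D n * frac (t (Suc n))"
  by (simp add: approx_error_def)

lemma approx_error_pos: "0 < D n"
  unfolding approx_error_def by (intro prod_pos) (simp add: frac_complete_quotient_pos del: frac_gt_0_iff)

lemma approx_error_decreasing: "D (Suc n) < D n"
  using approx_error_pos[of n] frac_lt_1[of "t (Suc n)"]
  by (simp add: approx_error_Suc)

lemma approx_error_complete_quotient: "D (Suc n) * t (Suc (Suc n)) = D n"
proof -
  have "frac (t (Suc n)) \<noteq> 0"
    using frac_complete_quotient_pos[of "Suc n"] by linarith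
  moreover have "t (Suc (Suc n)) = 1 / frac (t (Suc n))"
    by (rule complete_quotient.simps(2))
  ultimately show ?thesis by (simp add: approx_error_Suc)
qed

lemma approx_error_rec: "D (Suc (Suc n)) = D n - real (a (Suc (Suc n))) * D (Suc n)"
  using approx_error_complete_quotient[of n]
  by (simp add: approx_error_Suc[of "Suc n"] partial_quotient_eq algebra_simps)

lemma approx_error_0: "D 0 = frac \<xi>"
  by (simp add: approx_error_def)

lemma approx_error_1: "D (Suc 0) = 1 - real (a (Suc 0)) * frac \<xi>"
proof -
  have "frac \<xi> > 0" using frac_complete_quotient_pos[of 0] by simp
  moreover have "t (Suc 0) = 1 / frac \<xi>" by (simp add: complete_quotient.simps(2))
  ultimately have "frac \<xi> * t (Suc 0) = 1" by (metis nonzero_mult_div_cancel_left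
     less_irrefl times_divide_eq_right mult.right_neutral)
  then show ?thesis
    by (simp add: approx_error_Suc[of 0] approx_error_0 partial_quotient_eq algebra_simps)
qed

lemma convergent_error: "real (q n) * \<xi> - of_int (p n) = (-1) ^ n * D n"
proof (induction n rule: induct_nat_012)
  case 0
  then show ?case by (simp add: approx_error_0 frac_def)
next
  case 1
  then show ?case by (simp add: approx_error_1 frac_def algebra_simps)
next
  case (ge2 n)
  have "real (q (Suc (Suc n))) * \<xi> - of_int (p (Suc (Suc n)))
      = real (a (Suc (Suc n))) * (real (q (Suc n)) * \<xi> - of_int (p (Suc n)))
        + (real (q n) * \<xi> - of_int (p n))"
    by (simp add: algebra_simps)
  also have "\<dots> = (-1) ^ Suc (Suc n) * D (Suc (Suc n))"
    unfolding ge2 approx_error_rec by (simp add: algebra_simps)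
  finally show ?case .
qed

text \<open>The determinant of consecutive convergents in real form. It gives \<open>q (n + 1) * D n < 1\<close>, the
quality of approximation on which the boundedness argument for quadratic irrationals rests.\<close>

lemma denom_error_identity: "real (q (Suc n)) * D n + real (q n) * D (Suc n) = 1"
proof (induction n)
  case 0
  then show ?case by (simp add: approx_error_0 approx_error_1)
next
  case (Suc n)
  then show ?case by (simp add: approx_error_rec algebra_simps)
qed

lemma convergent_determinant: "p (Suc n) * int (q n) - p n * int (q (Suc n)) = (-1) ^ n"
proof (induction n)
  case 0
  then show ?case by simp
next
  case (Suc n)
  then show ?case by (simp add: algebra_simps)
qed

text \<open>Two consecutive convergents form a basis of the integer lattice, by \<open>convergent_determinant\<close>.
In the resulting formula for the error the two contributions have opposite signs, so a lattice
point with small error and small height has severely restricted coordinates.\<close>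

lemma convergents_basis:
  obtains x y :: int where
    "J = x * int (q n) + y * int (q (Suc n))"
    "k = x * p n + y * p (Suc n)"
    "of_int J * \<xi> - of_int k = (-1) ^ n * (of_int x * D n - of_int y * D (Suc n))"
proof -
  \<comment> \<open>Cramer's rule; \<open>s\<close> is the determinant and its own inverse.\<close>
  define s :: int where "s = (-1) ^ n"
  have ss: "s * s = 1" by (simp add: s_def flip: power_mult_distrib)
  have det: "p (Suc n) * int (q n) - p n * int (q (Suc n)) = s"
    by (simp add: convergent_determinant s_def)
  define x where "x = s * (J * p (Suc n) - k * int (q (Suc n)))"
  define y where "y = s * (k * int (q n) - J * p n)"
  have "x * int (q n) + y * int (q (Suc n))
      = s * J * (p (Suc n) * int (q n) - p n * int (q (Suc n)))"
    unfolding x_def y_def by algebra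
  then have J: "J = x * int (q n) + y * int (q (Suc n))"
    using ss unfolding det by (simp add: mult.assoc mult.left_commute[of s J])
  have "x * p n + y * p (Suc n)
      = s * k * (p (Suc n) * int (q n) - p n * int (q (Suc n)))"
    unfolding x_def y_def by algebra
  then have k: "k = x * p n + y * p (Suc n)"
    using ss unfolding det by (simp add: mult.assoc mult.left_commute[of s k])
  have "of_int J * \<xi> - of_int k = of_int x * (real (q n) * \<xi> - of_int (p n))
      + of_int y * (real (q (Suc n)) * \<xi> - of_int (p (Suc n)))"
    unfolding J k by (simp add: algebra_simps)
  also have "\<dots> = (-1) ^ n * (of_int x * D n - of_int y * D (Suc n))"
    unfolding convergent_error by (simp add: algebra_simps)
  finally show thesis using that J k by blast
qed

lemma convergent_denom_pos: "0 < q n"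
  using partial_quotient_pos by (induction n rule: induct_nat_012) (auto simp: Suc_le_eq)

lemma convergent_denom_mono: "q n \<le> q (Suc n)"
proof (cases n)
  case 0
  then show ?thesis using partial_quotient_pos[of 0] by simp
next
  case (Suc m)
  have "1 * q (Suc m) \<le> a (Suc (Suc m)) * q (Suc m)"
    by (intro mult_le_mono1 partial_quotient_pos)
  then show ?thesis unfolding Suc convergent_denom.simps by linarith
qed

end

section \<open>Symmetries of the walk at the convergents\<close>

text \<open>An integer-valued version of the walk, so that parities and orders can be handled without
coercions.\<close>

definition walk_step :: "real \<Rightarrow> nat \<Rightarrow> int" where
  "walk_step \<xi> j = (if even \<lfloor>2 * real j * \<xi>\<rfloor> then 1 else -1)"

definition int_walk :: "real \<Rightarrow> nat \<Rightarrow> int" where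
  "int_walk \<xi> n = (\<Sum>j = 1..n. walk_step \<xi> j)"

lemma walk_eq_int_walk: "walk (2 * \<xi>) n = of_int (int_walk \<xi> n)"
proof -
  have "(-1::real) powi \<lfloor>real j * (2 * \<xi>)\<rfloor> = of_int (walk_step \<xi> j)" for j
    by (simp add: walk_step_def mult_ac power_int_minus_one_minus)
  then show ?thesis by (simp add: walk_def int_walk_def)
qed

lemma int_walk_0 [simp]: "int_walk \<xi> 0 = 0"
  by (simp add: int_walk_def)

lemma int_walk_Suc: "int_walk \<xi> (Suc n) = int_walk \<xi> n + walk_step \<xi> (Suc n)"
  by (simp add: int_walk_def)

locale BR_walk =
  fixes \<xi> :: real
  assumes BR: "BR_number \<xi>"

sublocale BR_walk \<subseteq> irrational_number
  by unfold_locales (use BR in \<open>simp add: BR_number_def\<close>)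

context BR_walk
begin

abbreviation f :: "nat \<Rightarrow> int" where "f \<equiv> walk_step \<xi>"
abbreviation W :: "nat \<Rightarrow> int" where "W \<equiv> int_walk \<xi>"

definition half :: "nat \<Rightarrow> nat" where "half m = a (Suc (2 * m)) div 2"

text \<open>For odd index the denominator is even; its half is the turning point of the walk on that level.\<close>

definition half_denom :: "nat \<Rightarrow> nat" where "half_denom m = q (Suc (2 * m)) div 2"

lemma even_convergent_denom: "even (q (Suc (2 * m)))"
  using BR by (simp add: BR_number_def)

lemma double_half_denom: "q (Suc (2 * m)) = 2 * half_denom m"
  using even_convergent_denom[of m] by (simp add: half_denom_def)

lemma odd_convergent_denom: "odd (q (2 * m))"
proof
  assume "even (q (2 * m))"
  then have "even ((-1::int) ^ (2 * m))"
    unfolding convergent_determinant[of "2 * m", symmetric] using even_convergent_denom[of m]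
    by simp
  then show False by simp
qed

lemma odd_convergent_num: "odd (p (Suc (2 * m)))"
proof
  assume "even (p (Suc (2 * m)))"
  then have "even ((-1::int) ^ (2 * m))"
    unfolding convergent_determinant[of "2 * m", symmetric] using even_convergent_denom[of m]
    by simp
  then show False by simp
qed

lemma even_partial_quotient: "even (a (Suc (2 * m)))"
proof (cases m)
  case 0
  then show ?thesis using even_convergent_denom[of 0] by simp
next
  case (Suc l)
  have "even (a (Suc (2 * m)) * q (2 * m) + q (Suc (2 * l)))"
    using even_convergent_denom[of m] Suc by simp
  then show ?thesis
    using odd_convergent_denom[of m] even_convergent_denom[of l] by simp
qed

lemma double_half: "a (Suc (2 * m)) = 2 * half m"
  using even_partial_quotient[of m] by (simp add: half_def)

lemma half_pos: "1 \<le> half m"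
  using partial_quotient_pos[of "2 * m"] double_half[of m] by linarith

lemma half_denom_0: "half_denom 0 = half 0"
  by (simp add: half_denom_def half_def)

lemma half_denom_Suc: "half_denom (Suc m) = half (Suc m) * q (2 * Suc m) + half_denom m"
proof -
  have "q (Suc (2 * Suc m)) = a (Suc (2 * Suc m)) * q (2 * Suc m) + q (Suc (2 * m))" by simp
  then show ?thesis
    unfolding double_half_denom double_half by simp
qed

lemma half_denom_pos: "0 < half_denom m"
  using convergent_denom_pos[of "Suc (2 * m)"] double_half_denom[of m] by simp

text \<open>Best approximation, sharpened by parity. The coordinate \<open>x\<close> of an even \<open>J\<close> is even because the
other basis denominator is even. The range of \<open>J\<close> excludes \<open>x = 0\<close>, and positive \<open>x\<close> puts
\<open>J\<xi>\<close> on the wrong side of the integer, so \<open>x \<le> -2\<close>, which already costs more than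
\<open>2 * D (2m)\<close>. Without evenness \<open>x = -1\<close> would occur.\<close>

lemma no_even_multiple_below_integer:
  assumes "even J" "0 < J" "J < int (q (Suc (2 * m)))"
    and "0 < of_int k - of_int J * \<xi>" "of_int k - of_int J * \<xi> \<le> 2 * D (2 * m)"
  shows False
proof -
  obtain x y where J: "J = x * int (q (2 * m)) + y * int (q (Suc (2 * m)))"
    and e: "of_int J * \<xi> - of_int k = of_int x * D (2 * m) - of_int y * D (Suc (2 * m))"
    by (rule convergents_basis[of J "2 * m" k]) (use that in simp)
  have "even x"
    using J \<open>even J\<close> odd_convergent_denom[of m] even_convergent_denom[of m] by simp
  let ?E = "int (q (2 * m))" and ?O = "int (q (Suc (2 * m)))"
  have EO: "0 < ?E" "0 < ?O" using convergent_denom_pos by simp_all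
  have d: "0 < D (2 * m)" "0 < D (Suc (2 * m))" using approx_error_pos by auto
  have "x \<noteq> -1" using \<open>even x\<close> by auto
  then consider "x = 0" | "x > 0" | "x \<le> -2" by linarith
  then show False
  proof cases
    case 1
    then have "0 < y * ?O" "y * ?O < 1 * ?O" using J assms by auto
    then have "0 < y" "y < 1" using EO
      by (simp add: zero_less_mult_iff, simp only: mult_less_cancel_right_pos)
    then show False by simp
  next
    case 2
    have "x * ?E > 0" using 2 EO by simp
    then have "y * ?O < 1 * ?O" using J assms by linarith
    then have "y < 1" using EO by (simp only: mult_less_cancel_right_pos)
    then have "of_int y * D (Suc (2 * m)) \<le> 0" using d by (simp add: mult_nonpos_nonneg)
    moreover have "of_int x * D (2 * m) > 0" using 2 d by simp
    ultimately show False using e assms by linarith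
  next
    case 3
    have "x * ?E < 0" using 3 EO by (simp add: mult_neg_pos)
    then have "0 < y * ?O" using J assms by simp
    then have "0 < y" using EO by (simp add: zero_less_mult_iff)
    then have "of_int y * D (Suc (2 * m)) > 0" using d by simp
    moreover have "of_int x * D (2 * m) \<le> of_int (-2) * D (2 * m)"
      using 3 d by (intro mult_right_mono) linarith+
    ultimately show False using e assms by simp
  qed
qed

text \<open>The counterpart for errors of the other sign. Here the coordinate along the even-indexed
convergent is even; if it is at least \<open>2\<close>, the bound on \<open>J\<close> forces the other coordinate
down to \<open>-2\<close>, and the error is too large.\<close>

lemma no_even_multiple_above_integer:
  assumes "even J" "0 < J" "J \<le> 2 * int (q (2 * Suc m)) - 2 * int (q (Suc (2 * m)))"
    and "0 \<le> of_int J * \<xi> - of_int k" "of_int J * \<xi> - of_int k < 2 * D (Suc (2 * m))"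
  shows False
proof -
  obtain x y where J: "J = x * int (q (Suc (2 * m))) + y * int (q (2 * Suc m))"
    and e: "of_int J * \<xi> - of_int k = of_int y * D (2 * Suc m) - of_int x * D (Suc (2 * m))"
    by (rule convergents_basis[of J "Suc (2 * m)" k]) (use that in \<open>simp del: convergent_denom.simps\<close>)
  have "even y"
    using J \<open>even J\<close> odd_convergent_denom[of "Suc m"] even_convergent_denom[of m]
    by (simp del: convergent_denom.simps)
  let ?E = "int (q (2 * Suc m))" and ?O = "int (q (Suc (2 * m)))"
  have EO: "0 < ?E" "0 < ?O" using convergent_denom_pos
    by (simp_all del: convergent_denom.simps)
  have d: "0 < D (2 * Suc m)" "0 < D (Suc (2 * m))" using approx_error_pos by auto
  have "y \<noteq> 1" using \<open>even y\<close> by auto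
  then consider "y \<le> 0" | "y \<ge> 2" by linarith
  then show False
  proof cases
    case 1
    then have "y * ?E \<le> 0" using EO by (simp add: mult_nonpos_nonneg del: convergent_denom.simps)
    then have "0 < x * ?O" using J assms by simp
    then have "0 < x" using EO by (simp add: zero_less_mult_iff)
    then have "of_int x * D (Suc (2 * m)) > 0" using d by simp
    moreover have "of_int y * D (2 * Suc m) \<le> 0" using 1 d by (simp add: mult_nonpos_nonneg)
    ultimately show False using e assms by linarith
  next
    case 2
    have "2 * ?E \<le> y * ?E" using 2 EO by (intro mult_right_mono) linarith+
    then have "x * ?O \<le> (-2) * ?O" using J assms by linarith
    then have "x \<le> -2" using EO by (simp only: mult_le_cancel_right_pos)
    then have "of_int x * D (Suc (2 * m)) \<le> of_int (-2) * D (Suc (2 * m))"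
      using d by (intro mult_right_mono) linarith+
    moreover have "of_int y * D (2 * Suc m) > 0" using 2 d by simp
    ultimately show False using e assms by simp
  qed
qed

text \<open>Adding \<open>q (2m)\<close> to \<open>j\<close> moves \<open>2j\<xi>\<close> by the even integer \<open>2 * p (2m)\<close> and by \<open>2 * D (2m)\<close>. The
step could only change if this last move crossed an integer.\<close>

lemma walk_step_shift_even:
  assumes "1 \<le> j" "j < half_denom m"
  shows "f (q (2 * m) + j) = f j"
proof -
  define k where "k = \<lfloor>2 * real j * \<xi>\<rfloor>"
  have split: "2 * real (q (2 * m) + j) * \<xi> = 2 * of_int (p (2 * m)) + (2 * D (2 * m) + 2 * real j * \<xi>)"
    using convergent_error[of "2 * m"] by (simp add: algebra_simps)
  have "\<not> of_int (k + 1) - of_int (2 * int j) * \<xi> \<le> 2 * D (2 * m)"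
  proof
    assume *: "of_int (k + 1) - of_int (2 * int j) * \<xi> \<le> 2 * D (2 * m)"
    have "0 < of_int (k + 1) - of_int (2 * int j) * \<xi>" unfolding k_def by (simp; linarith)
    then show False
      by (rule no_even_multiple_below_integer[rotated 3, OF _ *])
        (use assms double_half_denom[of m] in auto)
  qed
  then have "\<lfloor>2 * D (2 * m) + 2 * real j * \<xi>\<rfloor> = k"
    using approx_error_pos[of "2 * m"] unfolding k_def by (simp; linarith)
  then have "\<lfloor>2 * real (q (2 * m) + j) * \<xi>\<rfloor> = 2 * p (2 * m) + k"
    unfolding split by (metis floor_add_int of_int_mult of_int_numeral add.commute)
  then show ?thesis by (simp add: walk_step_def k_def)
qed

lemma walk_step_shift_odd:
  assumes "1 \<le> j" "j \<le> q (2 * Suc m) - q (Suc (2 * m))"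
  shows "f (q (Suc (2 * m)) + j) = f j"
proof -
  define k where "k = \<lfloor>2 * real j * \<xi>\<rfloor>"
  let ?n = "Suc (2 * m)"
  have split: "2 * real (q ?n + j) * \<xi> = 2 * of_int (p ?n) + (2 * real j * \<xi> - 2 * D ?n)"
    using convergent_error[of ?n] by (simp add: algebra_simps)
  have "\<not> of_int (2 * int j) * \<xi> - of_int k < 2 * D ?n"
  proof
    assume *: "of_int (2 * int j) * \<xi> - of_int k < 2 * D ?n"
    have "0 \<le> of_int (2 * int j) * \<xi> - of_int k" unfolding k_def by simp
    then show False
      by (rule no_even_multiple_above_integer[rotated 3, OF _ *])
        (use assms in \<open>auto simp del: convergent_denom.simps\<close>)
  qed
  then have "\<lfloor>2 * real j * \<xi> - 2 * D ?n\<rfloor> = k"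
    using approx_error_pos[of ?n] unfolding k_def by (simp; linarith)
  then have "\<lfloor>2 * real (q ?n + j) * \<xi>\<rfloor> = 2 * p ?n + k"
    unfolding split by (metis floor_add_int of_int_mult of_int_numeral add.commute)
  then show ?thesis by (simp add: walk_step_def k_def)
qed

text \<open>Reflection turns \<open>2j\<xi>\<close> into \<open>-(2j\<xi> + 2 * D (2m+1))\<close> up to an even integer. Negating a
non-integer flips the parity of its integer part, and the small displacement crosses no integer
since \<open>D (2m+1) < D (2m)\<close>.\<close>

lemma walk_step_reflect:
  assumes "1 \<le> j" "j < half_denom m"
  shows "f (q (Suc (2 * m)) - j) = - f j"
proof -
  define k where "k = \<lfloor>2 * real j * \<xi>\<rfloor>"
  let ?n = "Suc (2 * m)"
  have "j \<le> q ?n" using assms double_half_denom[of m] by simp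
  then have split: "2 * real (q ?n - j) * \<xi> = 2 * of_int (p ?n) + - (2 * real j * \<xi> + 2 * D ?n)"
    using convergent_error[of ?n] by (simp add: algebra_simps of_nat_diff)
  have "\<not> of_int (k + 1) - of_int (2 * int j) * \<xi> \<le> 2 * D ?n"
  proof
    assume "of_int (k + 1) - of_int (2 * int j) * \<xi> \<le> 2 * D ?n"
    then have *: "of_int (k + 1) - of_int (2 * int j) * \<xi> \<le> 2 * D (2 * m)"
      using approx_error_decreasing[of "2 * m"] by linarith
    have "0 < of_int (k + 1) - of_int (2 * int j) * \<xi>" unfolding k_def by (simp; linarith)
    then show False
      by (rule no_even_multiple_below_integer[rotated 3, OF _ *])
        (use assms double_half_denom[of m] in auto)
  qed
  then have "\<lfloor>- (2 * real j * \<xi> + 2 * D ?n)\<rfloor> = - k - 1"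
    using approx_error_pos[of ?n] unfolding k_def by (simp; linarith)
  then have "\<lfloor>2 * real (q ?n - j) * \<xi>\<rfloor> = 2 * p ?n + (- k - 1)"
    unfolding split by (metis floor_add_int of_int_mult of_int_numeral add.commute)
  then show ?thesis by (simp add: walk_step_def k_def)
qed

text \<open>The first odd partial quotient is a positive even number, so it is at least \<open>2\<close>.\<close>

lemma approx_error_0_less_half: "2 * D 0 < 1"
proof -
  have "real (a 1) \<ge> 2" using double_half[of 0] half_pos[of 0] by simp
  then have "2 * D 0 \<le> real (a 1) * D 0" using approx_error_pos[of 0] by (intro mult_right_mono) auto
  then show ?thesis using approx_error_1 approx_error_pos[of 1] by (simp add: approx_error_0)
qed

lemma approx_error_less_half: "2 * D n < 1"
proof (induction n)
  case (Suc n)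
  then show ?case using approx_error_decreasing[of n] by linarith
qed (rule approx_error_0_less_half)

lemma walk_step_one: "f 1 = 1"
proof -
  have "2 * real (q 0) * \<xi> = 2 * of_int (p 0) + 2 * D 0"
    using convergent_error[of 0] by (simp add: algebra_simps)
  moreover have "\<lfloor>2 * D 0\<rfloor> = 0"
    using approx_error_0_less_half approx_error_pos[of 0] by linarith
  ultimately have "\<lfloor>2 * \<xi>\<rfloor> = 2 * p 0 + 0"
    by (metis floor_add_int of_int_mult of_int_numeral add.commute mult.right_neutral
        convergent_denom.simps(1) of_nat_1)
  then show ?thesis by (simp add: walk_step_def)
qed

text \<open>For \<open>j = half_denom m\<close> the number \<open>2j\<xi>\<close> lies just below the odd integer \<open>p (2m+1)\<close>.\<close>

lemma walk_step_half_denom: "f (half_denom m) = 1"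
proof -
  let ?n = "Suc (2 * m)"
  have "2 * real (half_denom m) * \<xi> = of_int (p ?n) + - D ?n"
    using convergent_error[of ?n] unfolding double_half_denom by (simp add: algebra_simps)
  moreover have "\<lfloor>- D ?n\<rfloor> = -1"
    using approx_error_less_half[of ?n] approx_error_pos[of ?n] by linarith
  ultimately have "\<lfloor>2 * real (half_denom m) * \<xi>\<rfloor> = p ?n + -1"
    by (metis floor_add_int add.commute)
  then show ?thesis using odd_convergent_num[of m] by (simp add: walk_step_def)
qed

lemma walk_step_convergent_denom: "f (q (Suc (2 * m))) = -1"
proof -
  let ?n = "Suc (2 * m)"
  have "2 * real (q ?n) * \<xi> = 2 * of_int (p ?n) + - (2 * D ?n)"
    using convergent_error[of ?n] by (simp add: algebra_simps)
  moreover have "\<lfloor>- (2 * D ?n)\<rfloor> = -1"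
    using approx_error_less_half[of ?n] approx_error_pos[of ?n] by linarith
  ultimately have "\<lfloor>2 * real (q ?n) * \<xi>\<rfloor> = 2 * p ?n + -1"
    by (metis floor_add_int of_int_mult of_int_numeral add.commute)
  then show ?thesis by (simp add: walk_step_def)
qed

end

section \<open>The records\<close>

lemma enumerate_range_strict_mono:
  fixes g :: "nat \<Rightarrow> nat"
  assumes "strict_mono g"
  shows "enumerate (range g) = g"
proof
  fix n
  have inf: "infinite (range g)"
    using assms by (intro range_inj_infinite strict_mono_imp_inj_on)
  have le: "g n \<le> g m \<longleftrightarrow> n \<le> m" and less: "g n < g m \<longleftrightarrow> n < m" for n m
    using assms by (simp_all add: strict_mono_less_eq strict_mono_less)
  show "enumerate (range g) n = g n"
  proof (induction n)
    case 0
    show ?case unfolding enumerate_0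
      by (rule Least_equality) (auto simp: le)
  next
    case (Suc n)
    show ?case unfolding enumerate_Suc''[OF inf] Suc
      by (rule Least_equality) (auto simp: le less)
  qed
qed

context BR_walk
begin

lemma walk_shift_even_aux:
  assumes "n < half_denom m"
  shows "W (q (2 * m) + n) = W (q (2 * m)) + W n"
  using assms
proof (induction n)
  case (Suc n)
  then show ?case
    using walk_step_shift_even[of "Suc n" m] by (simp add: int_walk_Suc)
qed simp

lemma walk_shift_odd_aux:
  assumes "n \<le> q (2 * Suc m) - q (Suc (2 * m))"
  shows "W (q (Suc (2 * m)) + n) = W (q (Suc (2 * m))) + W n"
  using assms
proof (induction n)
  case (Suc n)
  then have "f (q (Suc (2 * m)) + Suc n) = f (Suc n)"
    by (intro walk_step_shift_odd) simp_all
  moreover have "W (q (Suc (2 * m)) + n) = W (q (Suc (2 * m))) + W n"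
    using Suc by simp
  ultimately show ?case by (simp add: int_walk_Suc)
qed simp

text \<open>By \<open>walk_step_reflect\<close> the steps before the turning point are undone in reverse order after it;
the step at the turning point itself has no partner and lifts the mirror image by one.\<close>

lemma walk_second_half:
  assumes "n < half_denom m"
  shows "W (half_denom m + n) = 1 + W (half_denom m - 1 - n)"
  using assms
proof (induction n)
  case 0
  then show ?case
    using int_walk_Suc[of \<xi> "half_denom m - 1"] walk_step_half_denom[of m] by simp
next
  case (Suc n)
  define j where "j = half_denom m - Suc n"
  have "half_denom m + Suc n = q (Suc (2 * m)) - j"
    using Suc.prems double_half_denom[of m] by (simp add: j_def)
  then have "f (half_denom m + Suc n) = - f j"
    using walk_step_reflect[of j m] Suc.prems by (simp add: j_def)
  moreover have "W j = W (j - 1) + f j"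
    using int_walk_Suc[of \<xi> "j - 1"] Suc.prems by (simp add: j_def Suc_diff_Suc)
  ultimately show ?case
    using Suc by (simp add: int_walk_Suc j_def)
qed

lemma walk_odd_convergent_denom: "W (q (Suc (2 * m))) = 0"
proof -
  have "half_denom m + (half_denom m - 1) = q (Suc (2 * m)) - 1"
    using double_half_denom[of m] by simp
  then have "W (q (Suc (2 * m)) - 1) = 1"
    using walk_second_half[of "half_denom m - 1" m] half_denom_pos[of m] by simp
  then show ?thesis
    using int_walk_Suc[of \<xi> "q (Suc (2 * m)) - 1"] convergent_denom_pos[of "Suc (2 * m)"]
      walk_step_convergent_denom[of m] by simp
qed

lemma walk_shift_odd:
  assumes "n + q (Suc (2 * m)) \<le> q (2 * Suc m)"
  shows "W (q (Suc (2 * m)) + n) = W n"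
  using walk_shift_odd_aux[of n m] assms walk_odd_convergent_denom[of m]
  by (simp del: convergent_denom.simps)

lemma walk_mod_odd:
  assumes "k * q (Suc (2 * m)) + n \<le> q (2 * Suc m)"
  shows "W (k * q (Suc (2 * m)) + n) = W n"
  using assms
proof (induction k)
  case (Suc k)
  then show ?case
    using walk_shift_odd[of "k * q (Suc (2 * m)) + n" m]
    by (simp add: ac_simps del: convergent_denom.simps)
qed simp

text \<open>Since \<open>q (2m+2)\<close> is \<open>q (2m)\<close> plus a multiple of \<open>q (2m+1)\<close>, the value descends along the
levels to the single first step.\<close>

lemma walk_even_convergent_denom: "W (q (2 * m)) = 1"
proof (induction m)
  case 0
  then show ?case using walk_step_one by (simp add: int_walk_def)
next
  case (Suc m)
  have "q (2 * Suc m) = a (2 * Suc m) * q (Suc (2 * m)) + q (2 * m)" by simp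
  then show ?case
    using walk_mod_odd[of "a (2 * Suc m)" m "q (2 * m)"] Suc by (simp del: convergent_denom.simps)
qed

lemma walk_shift_even:
  assumes "n < half_denom m"
  shows "W (q (2 * m) + n) = 1 + W n"
  using walk_shift_even_aux[OF assms] walk_even_convergent_denom by simp

lemma walk_mod_even:
  assumes "k * q (2 * m) + n < half_denom m + q (2 * m)"
  shows "W (k * q (2 * m) + n) = int k + W n"
  using assms
proof (induction k)
  case (Suc k)
  then show ?case
    using walk_shift_even[of "k * q (2 * m) + n" m] by (simp add: ac_simps)
qed simp

definition level_height :: "nat \<Rightarrow> nat" where
  "level_height m = (\<Sum>l<m. half l)"

text \<open>The walk reaches \<open>level_height m\<close> for the first time at \<open>level_time m\<close>. The sum is the
Ostrowski expansion of that time; it telescopes to \<open>q (2m-1) / 2\<close> for \<open>m > 0\<close>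
(\<open>level_time_Suc\<close>).\<close>

definition level_time :: "nat \<Rightarrow> nat" where
  "level_time m = (\<Sum>l<m. half l * q (2 * l))"

lemma level_height_Suc [simp]: "level_height (Suc m) = level_height m + half m"
  by (simp add: level_height_def)

lemma level_time_Suc: "level_time (Suc m) = half_denom m"
proof (induction m)
  case 0
  then show ?case by (simp add: level_time_def half_denom_0)
next
  case (Suc m)
  then show ?case unfolding half_denom_Suc by (simp add: level_time_def)
qed

lemma level_height_0 [simp]: "level_height 0 = 0" and level_time_0 [simp]: "level_time 0 = 0"
  by (simp_all add: level_height_def level_time_def)

lemma half_denom_level: "half_denom m = half m * q (2 * m) + level_time m"
  by (cases m) (simp_all add: half_denom_0 half_denom_Suc level_time_Suc del: convergent_denom.simps(3))

lemma level_time_less: "level_time m < q (2 * m)"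
proof (cases m)
  case (Suc l)
  have "q (Suc (2 * l)) \<le> q (2 * Suc l)" using convergent_denom_mono[of "Suc (2 * l)"] by simp
  then show ?thesis
    using Suc double_half_denom[of l] half_denom_pos[of l] by (simp add: level_time_Suc)
qed simp

lemma walk_level_time: "W (level_time m) = int (level_height m)"
proof (induction m)
  case (Suc m)
  have "half m * q (2 * m) + level_time m < half_denom m + q (2 * m)"
    using level_time_less[of m] half_denom_level[of m] by simp
  then have "W (half_denom m) = int (half m) + W (level_time m)"
    using walk_mod_even unfolding half_denom_level by blast
  then show ?case using Suc by (simp add: level_time_Suc)
qed simp

text \<open>The induction invariant. The strict bound before \<open>level_time m\<close> is what makes the incomplete last
block in \<open>walk_before_record\<close> stay below the next record value.\<close>

definition level_bounds :: "nat \<Rightarrow> bool" where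
  "level_bounds m \<longleftrightarrow>
     (\<forall>n<q (2 * m). 0 \<le> W n \<and> W n \<le> int (level_height m)) \<and>
     (\<forall>n<level_time m. W n < int (level_height m))"

text \<open>Cut \<open>n\<close> into \<open>k\<close> blocks of length \<open>q (2m)\<close> and a rest \<open>r\<close>, so that the walk at \<open>n\<close> is
\<open>k + W r\<close>. Either \<open>k < c\<close> and the weak bound on \<open>W r\<close> suffices, or \<open>k = c\<close> and \<open>r\<close> lies before
\<open>level_time m\<close>, where the bound is strict.\<close>

lemma walk_before_record:
  assumes "level_bounds m" "c \<le> half m" "n < level_time m + c * q (2 * m)"
  shows "0 \<le> W n \<and> W n < int (level_height m + c)"
proof -
  define k where "k = n div q (2 * m)"
  define r where "r = n mod q (2 * m)"
  have n: "n = k * q (2 * m) + r"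
    unfolding k_def r_def by (rule div_mult_mod_eq[symmetric])
  have r: "r < q (2 * m)"
    using convergent_denom_pos[of "2 * m"] by (simp add: r_def)
  have "c * q (2 * m) \<le> half m * q (2 * m)" using assms by simp
  then have "n < half_denom m + q (2 * m)"
    using assms unfolding half_denom_level by linarith
  then have W: "W n = int k + W r"
    using walk_mod_even unfolding n by blast
  have "k * q (2 * m) < Suc c * q (2 * m)"
    using assms(3) level_time_less[of m] unfolding n mult_Suc by linarith
  then have "k < Suc c" by (simp only: mult_less_cancel2)
  moreover have "r < level_time m" if "k = c"
    using assms(3) that unfolding n by simp
  ultimately consider "k < c" | "k = c" "r < level_time m" by linarith
  then show ?thesis
  proof cases
    case 1
    moreover have "0 \<le> W r" "W r \<le> int (level_height m)"
      using assms(1) r unfolding level_bounds_def by blast+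
    ultimately show ?thesis unfolding W by linarith
  next
    case 2
    moreover have "0 \<le> W r" "W r < int (level_height m)"
      using assms(1) r 2 unfolding level_bounds_def by blast+
    ultimately show ?thesis unfolding W by linarith
  qed
qed

lemma walk_level_bounds: "level_bounds m"
proof (induction m)
  case 0
  then show ?case by (simp add: level_bounds_def)
next
  case (Suc m)
  \<comment> \<open>First half, mirror image, then repetition with period \<open>q (2m+1)\<close>: three ranges, each reduced to the one before.\<close>
  have 1: "0 \<le> W n \<and> W n < int (level_height (Suc m))" if "n < half_denom m" for n
    using walk_before_record[OF Suc order_refl, of n] that unfolding half_denom_level by simp
  have 2: "0 \<le> W n \<and> W n \<le> int (level_height (Suc m))" if "n < q (Suc (2 * m))" for n
  proof (cases "n < half_denom m")
    case False
    then have "W n = 1 + W (half_denom m - 1 - (n - half_denom m))"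
      using walk_second_half[of "n - half_denom m" m] that double_half_denom[of m] by simp
    then show ?thesis
      using 1[of "half_denom m - 1 - (n - half_denom m)"] half_denom_pos[of m] by simp
  next
    case True
    then show ?thesis using 1[OF True] by simp
  qed
  have 3: "0 \<le> W n \<and> W n \<le> int (level_height (Suc m))" if "n < q (2 * Suc m)" for n
  proof -
    have "W n = W (n mod q (Suc (2 * m)))"
      using walk_mod_odd[of "n div q (Suc (2 * m))" m "n mod q (Suc (2 * m))"] that
      unfolding div_mult_mod_eq by simp
    then show ?thesis
      using 2 convergent_denom_pos[of "Suc (2 * m)"] by simp
  qed
  show ?case
    unfolding level_bounds_def level_time_Suc using 1 3 by blast
qed

lemma walk_first_hit:
  assumes "c \<le> half m"
  shows "W (level_time m + c * q (2 * m)) = int (level_height m + c)"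
    and "n < level_time m + c * q (2 * m) \<Longrightarrow> W n < int (level_height m + c)"
proof -
  have "c * q (2 * m) \<le> half m * q (2 * m)" using assms by simp
  then have "c * q (2 * m) + level_time m < half_denom m + q (2 * m)"
    using convergent_denom_pos[of "2 * m"] unfolding half_denom_level by linarith
  then show "W (level_time m + c * q (2 * m)) = int (level_height m + c)"
    using walk_mod_even[of c m "level_time m"] walk_level_time by (simp add: ac_simps)
  show "n < level_time m + c * q (2 * m) \<Longrightarrow> W n < int (level_height m + c)"
    using walk_before_record[OF walk_level_bounds assms] by blast
qed

lemma le_level_height: "m \<le> level_height m"
proof (induction m)
  case (Suc m)
  then show ?case using half_pos[of m] by simp
qed simp

lemma walk_nonneg: "0 \<le> W n"
proof -
  have "n \<le> level_height n" by (rule le_level_height)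
  also have "level_height n \<le> level_time n"
    unfolding level_height_def level_time_def
    using convergent_denom_pos by (intro sum_mono) (simp add: Suc_le_eq)
  also have "\<dots> < q (2 * n)" by (rule level_time_less)
  finally show ?thesis using walk_level_bounds[of n] by (simp add: level_bounds_def)
qed

text \<open>The heights of the levels cut the natural numbers into consecutive intervals; a value is reached
for the first time on the level whose interval contains it.\<close>

lemma level_decomposition:
  obtains m c where "v = level_height m + c" "c < half m"
proof -
  have "\<exists>m c. v = level_height m + c \<and> c < half m"
  proof (induction v)
    case 0
    then show ?case using half_pos[of 0] by (intro exI[of _ 0]) simp
  next
    case (Suc v)
    then obtain m c where mc: "v = level_height m + c" "c < half m" by blast
    show ?case
    proof (cases "Suc c < half m")
      case True
      then show ?thesis using mc by (intro exI[of _ m] exI[of _ "Suc c"]) simp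
    next
      case False
      then show ?thesis using mc half_pos[of "Suc m"]
        by (intro exI[of _ "Suc m"] exI[of _ 0]) simp
    qed
  qed
  then show thesis using that by blast
qed

definition first_hit :: "nat \<Rightarrow> nat" where
  "first_hit v = (LEAST n. W n = int v)"

lemma first_hit_level:
  assumes "c \<le> half m"
  shows "first_hit (level_height m + c) = level_time m + c * q (2 * m)"
  unfolding first_hit_def
proof (rule Least_equality)
  show "W (level_time m + c * q (2 * m)) = int (level_height m + c)"
    by (rule walk_first_hit(1)[OF assms])
  show "level_time m + c * q (2 * m) \<le> n" if "W n = int (level_height m + c)" for n
    using walk_first_hit(2)[OF assms, of n] that by (cases "n < level_time m + c * q (2 * m)") auto
qed

lemma first_hit_props:
  shows "W (first_hit v) = int v" and "n < first_hit v \<Longrightarrow> W n < int v"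
proof -
  obtain m c where "v = level_height m + c" "c < half m" by (rule level_decomposition)
  then show "W (first_hit v) = int v" and "n < first_hit v \<Longrightarrow> W n < int v"
    using walk_first_hit[of c m] first_hit_level[of c m] by simp_all
qed

lemma strict_mono_first_hit: "strict_mono first_hit"
proof (rule strict_monoI)
  fix v w :: nat
  assume "v < w"
  moreover have "\<not> first_hit w < first_hit v"
    using first_hit_props(2)[of "first_hit w" v] first_hit_props(1)[of w] \<open>v < w\<close> by auto
  moreover have "first_hit w \<noteq> first_hit v"
    using first_hit_props(1)[of v] first_hit_props(1)[of w] \<open>v < w\<close> by auto
  ultimately show "first_hit v < first_hit w" by simp
qed

text \<open>A record is the first visit to its value, that value is a natural number as the walk is never
negative, and conversely every first visit is a record.\<close>

lemma records_eq_range_first_hit: "records (walk (2 * \<xi>)) = range first_hit"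
proof -
  have "records (walk (2 * \<xi>)) = {r. \<forall>n<r. W n \<noteq> W r}"
    by (simp add: records_def walk_eq_int_walk)
  also have "\<dots> = range first_hit"
  proof (intro equalityI subsetI)
    fix r assume r: "r \<in> {r. \<forall>n<r. W n \<noteq> W r}"
    define v where "v = nat (W r)"
    have v: "W r = int v" using walk_nonneg[of r] by (simp add: v_def)
    have "\<not> first_hit v < r" using r v first_hit_props(1)[of v] by auto
    moreover have "\<not> r < first_hit v" using v first_hit_props(2)[of r v] by auto
    ultimately have "r = first_hit v" by simp
    then show "r \<in> range first_hit" by blast
  next
    fix r assume "r \<in> range first_hit"
    then obtain v where r: "r = first_hit v" by blast
    then have "W n \<noteq> W r" if "n < r" for n
      using first_hit_props(1)[of v] first_hit_props(2)[of n v] that by simp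
    then show "r \<in> {r. \<forall>n<r. W n \<noteq> W r}" by blast
  qed
  finally show ?thesis .
qed

lemma infinite_records: "infinite (records (walk (2 * \<xi>)))"
  unfolding records_eq_range_first_hit
  by (intro range_inj_infinite strict_mono_imp_inj_on strict_mono_first_hit)

lemma enumerate_records: "enumerate (records (walk (2 * \<xi>))) = first_hit"
  unfolding records_eq_range_first_hit
  by (rule enumerate_range_strict_mono[OF strict_mono_first_hit])

end

section \<open>Quadratic irrationals have eventually periodic partial quotients\<close>

lemma finite_quadratic_roots:
  fixes A B C :: real
  assumes "C \<noteq> 0"
  shows "finite {x. A + B * x + C * x\<^sup>2 = 0}"
proof -
  have "finite {x. (\<Sum>i\<le>2. [A, B, C] ! i * x ^ i) = 0}"
    by (rule polyfun_roots_finite[of _ 2]) (use assms in simp_all)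
  moreover have "(\<Sum>i\<le>2. [A, B, C] ! i * x ^ i) = A + B * x + C * x\<^sup>2" for x
    by (simp add: numeral_2_eq_2)
  ultimately show ?thesis by simp
qed

context irrational_number
begin

text \<open>Substituting \<open>\<xi> = (p n + x * p (n+1)) / (q n + x * q (n+1))\<close>, with \<open>x\<close> the complete quotient, into
the equation of \<open>\<xi>\<close> gives a quadratic equation for \<open>x\<close>. Its outer coefficients are the values
of the quadratic form at the convergents; since the form vanishes at \<open>(\<xi>, 1)\<close> and
\<open>q n * D n \<le> 1\<close>, these values, and the mixed one, are bounded independently of \<open>n\<close>.\<close>

lemma complete_quotient_quadratic_equation:
  fixes \<alpha> \<beta> \<gamma> :: int
  defines "K \<equiv> 2 * (\<bar>2 * of_int \<alpha> * \<xi> + of_int \<beta>\<bar> + \<bar>of_int \<alpha>\<bar>)"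
  assumes "\<alpha> \<noteq> 0" and root: "of_int \<alpha> * \<xi>\<^sup>2 + of_int \<beta> * \<xi> + of_int \<gamma> = 0"
  obtains A B C :: int where
    "of_int A + of_int B * t (Suc (Suc n)) + of_int C * (t (Suc (Suc n)))\<^sup>2 = 0"
    "C \<noteq> 0" "\<bar>of_int A\<bar> \<le> K" "\<bar>of_int B\<bar> \<le> K" "\<bar>of_int C\<bar> \<le> K"
proof -
  define g where "g = (\<lambda>n. \<alpha> * (p n)\<^sup>2 + \<beta> * p n * int (q n) + \<gamma> * (int (q n))\<^sup>2)"
  define h where "h = 2 * \<alpha> * p n * p (Suc n)
    + \<beta> * (p n * int (q (Suc n)) + p (Suc n) * int (q n)) + 2 * \<gamma> * int (q n) * int (q (Suc n))"
  define s where "s = (2 * of_int \<alpha> * \<xi> + of_int \<beta> :: real)"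
  define e where "e = (\<lambda>n. (-1) ^ n * D n)"
  have p: "of_int (p n) = real (q n) * \<xi> - e n" for n
    using convergent_error[of n] by (simp add: e_def)
  \<comment> \<open>Eliminating \<open>\<gamma>\<close> exhibits the error \<open>e n\<close> as a factor of the form.\<close>
  have \<gamma>: "of_int \<gamma> = - of_int \<alpha> * \<xi>\<^sup>2 - of_int \<beta> * \<xi>" using root by linarith
  have g: "of_int (g n) = - (e n * real (q n)) * s + of_int \<alpha> * (e n)\<^sup>2" for n
    unfolding g_def s_def of_int_add of_int_mult of_int_power of_int_of_nat_eq p \<gamma>
    by (simp add: power2_eq_square algebra_simps)
  have h: "of_int h = - (e n * real (q (Suc n)) + e (Suc n) * real (q n)) * s
      + 2 * of_int \<alpha> * e n * e (Suc n)"
    unfolding h_def s_def of_int_add of_int_mult of_int_power of_int_of_nat_eq p \<gamma>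
    by (simp add: power2_eq_square algebra_simps)
  define x where "x = t (Suc (Suc n))"
  have "e n + x * e (Suc n) = 0"
    using approx_error_complete_quotient[of n]
    by (simp add: e_def x_def algebra_simps flip: distrib_left)
  then have uv: "of_int (p n) + x * of_int (p (Suc n)) = (real (q n) + x * real (q (Suc n))) * \<xi>"
    unfolding p by (simp add: algebra_simps)
  let ?u = "of_int (p n) + x * of_int (p (Suc n))" and ?v = "real (q n) + x * real (q (Suc n))"
  have "of_int (g n) + of_int h * x + of_int (g (Suc n)) * x\<^sup>2
      = of_int \<alpha> * ?u\<^sup>2 + of_int \<beta> * ?u * ?v + of_int \<gamma> * ?v\<^sup>2"
    unfolding g_def h_def by (simp add: power2_eq_square algebra_simps del: convergent_denom.simps convergent_num.simps)
  also have "\<dots> = ?v\<^sup>2 * (of_int \<alpha> * \<xi>\<^sup>2 + of_int \<beta> * \<xi> + of_int \<gamma>)"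
    unfolding uv by (simp add: power2_eq_square algebra_simps)
  finally have eq: "of_int (g n) + of_int h * t (Suc (Suc n)) + of_int (g (Suc n)) * (t (Suc (Suc n)))\<^sup>2 = 0"
    using root by (simp add: x_def)
  \<comment> \<open>A zero of the form at an integer point would make \<open>\<xi>\<close> rational: one root of the quadratic would be rational, hence both.\<close>
  have nz: "g n \<noteq> 0" for n
  proof
    assume "g n = 0"
    then have "e n * (of_int \<alpha> * e n - real (q n) * s) = 0"
      using g[of n] by (auto simp: power2_eq_square algebra_simps)
    moreover have "e n \<noteq> 0" using approx_error_pos[of n] by (simp add: e_def)
    ultimately have "of_int \<alpha> * e n = real (q n) * s" by simp
    then have "of_int \<alpha> * (real (q n) * \<xi> - of_int (p n)) = real (q n) * s"
      using p[of n] by simp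
    then have "of_int (\<alpha> * int (q n)) * \<xi> = of_int (- \<alpha> * p n - \<beta> * int (q n))"
      unfolding s_def by (simp add: algebra_simps)
    moreover have "\<alpha> * int (q n) \<noteq> 0" using \<open>\<alpha> \<noteq> 0\<close> convergent_denom_pos[of n] by simp
    ultimately have "\<xi> = of_int (- \<alpha> * p n - \<beta> * int (q n)) / of_int (\<alpha> * int (q n))"
      by (simp add: nonzero_eq_divide_eq mult.commute)
    then show False using irrational by (metis Rats_divide Rats_of_int)
  qed
  have D: "0 < D n" "D n \<le> 1" for n
  proof -
    show "0 < D n" by (rule approx_error_pos)
    show "D n \<le> 1"
      using approx_error_decreasing approx_error_0 frac_lt_1[of \<xi>]
      by (induction n) (auto intro: less_imp_le less_trans order.strict_trans2)
  qed
  have ae: "\<bar>e n\<bar> = D n" for n using D[of n] by (simp add: e_def abs_mult)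
  have b1: "real (q (Suc n)) * D n \<le> 1" and b2: "real (q n) * D (Suc n) \<le> 1" for n
  proof -
    have "0 \<le> real (q n) * D (Suc n)" "0 \<le> real (q (Suc n)) * D n"
      using D(1)[of n] D(1)[of "Suc n"] by (simp_all del: convergent_denom.simps)
    then show "real (q (Suc n)) * D n \<le> 1" "real (q n) * D (Suc n) \<le> 1"
      using denom_error_identity[of n] by linarith+
  qed
  have b3: "real (q n) * D n \<le> 1" for n
  proof -
    have "real (q n) * D n \<le> real (q (Suc n)) * D n"
      using convergent_denom_mono[of n] D(1)[of n] by (intro mult_right_mono) linarith+
    then show ?thesis using b1[of n] by linarith
  qed
  have g_bound: "\<bar>of_int (g n)\<bar> \<le> K" for n
  proof -
    have "\<bar>of_int (g n)\<bar> \<le> \<bar>e n * real (q n)\<bar> * \<bar>s\<bar> + \<bar>of_int \<alpha>\<bar> * \<bar>e n\<bar>\<^sup>2"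
      unfolding g by (rule order_trans[OF abs_triangle_ineq]) (simp add: abs_mult)
    also have "\<dots> \<le> 1 * \<bar>s\<bar> + \<bar>of_int \<alpha>\<bar> * 1"
    proof (intro add_mono mult_mono)
      show "\<bar>e n * real (q n)\<bar> \<le> 1" using b3 D[of n] by (simp add: abs_mult ae mult.commute)
      show "\<bar>e n\<bar>\<^sup>2 \<le> 1" using D[of n] by (simp add: ae power_le_one)
    qed auto
    also have "\<dots> \<le> K"
      using mult_right_mono[of 1 2 "\<bar>s\<bar> + \<bar>of_int \<alpha>\<bar>"] by (simp add: K_def s_def)
    finally show ?thesis .
  qed
  have "\<bar>of_int h\<bar> \<le> \<bar>e n * real (q (Suc n)) + e (Suc n) * real (q n)\<bar> * \<bar>s\<bar>
      + 2 * \<bar>of_int \<alpha>\<bar> * (\<bar>e n\<bar> * \<bar>e (Suc n)\<bar>)"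
    unfolding h by (rule order_trans[OF abs_triangle_ineq])
      (simp only: abs_mult abs_minus_cancel abs_numeral mult.assoc order_refl)
  also have "\<dots> \<le> 2 * \<bar>s\<bar> + 2 * \<bar>of_int \<alpha>\<bar> * 1"
  proof (intro add_mono mult_mono)
    have "\<bar>e n * real (q (Suc n)) + e (Suc n) * real (q n)\<bar> \<le> 1 + 1"
      by (rule order_trans[OF abs_triangle_ineq add_mono])
        (use b1[of n] b2[of n] D in \<open>simp_all add: abs_mult ae mult.commute del: convergent_denom.simps\<close>)
    then show "\<bar>e n * real (q (Suc n)) + e (Suc n) * real (q n)\<bar> \<le> 2" by simp
    show "\<bar>e n\<bar> * \<bar>e (Suc n)\<bar> \<le> 1" using D[of n] D[of "Suc n"] by (simp add: ae mult_le_one)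
  qed auto
  finally have "\<bar>of_int h\<bar> \<le> K" by (simp add: s_def K_def)
  then show thesis using that[OF eq nz g_bound _ g_bound] by blast
qed

text \<open>Finitely many quadratic equations have finitely many roots. The leading coefficient has to be
non-zero here, since the zero polynomial has infinitely many roots.\<close>

lemma finite_complete_quotients:
  assumes "quadratic_irrational \<xi>"
  shows "finite (range (\<lambda>n. t (Suc (Suc n))))"
proof -
  obtain \<alpha> \<beta> \<gamma> :: int where \<alpha>: "\<alpha> \<noteq> 0"
    and root: "of_int \<alpha> * \<xi>\<^sup>2 + of_int \<beta> * \<xi> + of_int \<gamma> = 0"
    using assms by (auto simp: quadratic_irrational_def)
  define K where "K = 2 * (\<bar>2 * of_int \<alpha> * \<xi> + of_int \<beta>\<bar> + \<bar>of_int \<alpha>\<bar>)"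
  define I where "I = {-\<lceil>K\<rceil>..\<lceil>K\<rceil>}"
  define R where "R = (\<Union>A\<in>I. \<Union>B\<in>I. \<Union>C\<in>I - {0}.
    {x. of_int A + of_int B * x + of_int C * x\<^sup>2 = (0::real)})"
  have "finite R" unfolding R_def by (intro finite_UN_I finite_quadratic_roots) (auto simp: I_def)
  moreover have "t (Suc (Suc n)) \<in> R" for n
  proof -
    obtain A B C :: int
      where "of_int A + of_int B * t (Suc (Suc n)) + of_int C * (t (Suc (Suc n)))\<^sup>2 = 0"
        and "C \<noteq> 0" "\<bar>of_int A\<bar> \<le> K" "\<bar>of_int B\<bar> \<le> K" "\<bar>of_int C\<bar> \<le> K"
      unfolding K_def by (rule complete_quotient_quadratic_equation[OF \<alpha> root])
    moreover have "z \<in> I" if "\<bar>of_int z\<bar> \<le> K" for z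
      using that unfolding I_def by (simp, linarith)
    ultimately show ?thesis unfolding R_def by blast
  qed
  ultimately show ?thesis by (meson finite_subset image_subsetI)
qed

text \<open>Lagrange's theorem: two equal complete quotients have the same continuation.\<close>

lemma partial_quotients_eventually_periodic:
  assumes "quadratic_irrational \<xi>"
  obtains N T where "0 < T" "\<And>n. N \<le> n \<Longrightarrow> a (n + T) = a n"
proof -
  have "\<not> inj (\<lambda>n. t (Suc (Suc n)))"
    using finite_complete_quotients[OF assms] finite_imageD infinite_UNIV_nat by blast
  then obtain i j where "i \<noteq> j" "t (Suc (Suc i)) = t (Suc (Suc j))" by (auto simp: inj_def)
  then obtain i j where "i < j" and ij: "t (Suc (Suc i)) = t (Suc (Suc j))"
    by (metis linorder_neqE_nat)
  have "t (Suc (Suc i) + k) = t (Suc (Suc j) + k)" for k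
    by (induction k) (use ij in \<open>simp_all add: complete_quotient.simps(2)\<close>)
  then have *: "a (Suc (Suc i) + k) = a (Suc (Suc j) + k)" for k
    by (simp add: partial_quotient_def)
  show thesis
  proof (rule that[of "j - i" "Suc (Suc i)"])
    show "0 < j - i" using \<open>i < j\<close> by simp
    show "a (n + (j - i)) = a n" if "Suc (Suc i) \<le> n" for n
    proof -
      have "Suc (Suc i) + (n - Suc (Suc i)) = n" "Suc (Suc j) + (n - Suc (Suc i)) = n + (j - i)"
        using that \<open>i < j\<close> by simp_all
      then show ?thesis using *[of "n - Suc (Suc i)"] by metis
    qed
  qed
qed

end

section \<open>Ostrowski numeration\<close>

context irrational_number
begin

text \<open>The digit conditions for a digit function instead of a list, so that truncation is a change of
\<open>k\<close> only.\<close>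

definition admissible :: "nat \<Rightarrow> (nat \<Rightarrow> nat) \<Rightarrow> bool" where
  "admissible k d \<longleftrightarrow> (0 < k \<longrightarrow> d 0 < a 1) \<and>
     (\<forall>i. 1 \<le> i \<and> i < k \<longrightarrow> d i \<le> a (i + 1) \<and> (d i = a (i + 1) \<longrightarrow> d (i - 1) = 0))"

lemma is_ostrowski_rep_iff_admissible:
  "is_ostrowski_rep \<xi> N b \<longleftrightarrow> N = (\<Sum>i<length b. b ! i * q i) \<and>
     (b \<noteq> [] \<longrightarrow> last b \<noteq> 0) \<and> admissible (length b) ((!) b)"
  unfolding is_ostrowski_rep_def admissible_def by auto

lemma admissible_mono: "admissible k d \<Longrightarrow> j \<le> k \<Longrightarrow> admissible j d"
  unfolding admissible_def by auto

lemma admissible_cong: "(\<And>i. i < k \<Longrightarrow> d i = d' i) \<Longrightarrow> admissible k d \<longleftrightarrow> admissible k d'"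
  unfolding admissible_def by (cases k) auto

text \<open>The carry rule is what makes this hold: a maximal top digit leaves no room for the next lower one,
and the remaining sum then only has to fit below \<open>q k\<close> in the recursion for the denominators.\<close>

lemma admissible_sum_less: "admissible k d \<Longrightarrow> (\<Sum>i<k. d i * q i) < q k"
proof (induction k rule: induct_nat_012)
  case 0
  then show ?case by simp
next
  case 1
  then show ?case by (simp add: admissible_def)
next
  case (ge2 k)
  have d: "d (Suc k) \<le> a (Suc (Suc k))" "d (Suc k) = a (Suc (Suc k)) \<Longrightarrow> d k = 0"
    using ge2.prems unfolding admissible_def by (metis Suc_eq_plus1 diff_Suc_1 le_add2 lessI)+
  have IH: "(\<Sum>i<k. d i * q i) < q k" "(\<Sum>i<Suc k. d i * q i) < q (Suc k)"
    using ge2.IH admissible_mono[OF ge2.prems] by simp_all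
  show ?case
  proof (cases "d (Suc k) = a (Suc (Suc k))")
    case True
    then show ?thesis using d(2) IH(1) by simp
  next
    case False
    then have "Suc (d (Suc k)) * q (Suc k) \<le> a (Suc (Suc k)) * q (Suc k)"
      using d(1) by (intro mult_le_mono1) simp
    then show ?thesis using IH(2) by simp
  qed
qed

text \<open>By \<open>admissible_sum_less\<close> the top digit is the quotient by the top denominator.\<close>

lemma admissible_digits_unique:
  assumes "admissible k d" "admissible k d'" "(\<Sum>i<k. d i * q i) = (\<Sum>i<k. d' i * q i)" "i < k"
  shows "d i = d' i"
  using assms
proof (induction k)
  case (Suc k)
  have less: "(\<Sum>i<k. d i * q i) < q k" "(\<Sum>i<k. d' i * q i) < q k"
    using Suc.prems admissible_mono admissible_sum_less by (meson le_Suc_eq order_refl)+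
  have "d k = (\<Sum>i<Suc k. d i * q i) div q k" using less by simp
  also have "\<dots> = d' k" unfolding Suc.prems(3) using less by simp
  finally have k: "d k = d' k" .
  then have "(\<Sum>i<k. d i * q i) = (\<Sum>i<k. d' i * q i)" using Suc.prems(3) by simp
  then show ?case
    using Suc.IH Suc.prems admissible_mono k by (metis le_Suc_eq less_antisym order_refl)
qed simp

lemma ostrowski_rep_unique:
  assumes "is_ostrowski_rep \<xi> N b" "is_ostrowski_rep \<xi> N b'"
  shows "b = b'"
proof -
  have bounds: "b \<noteq> [] \<Longrightarrow> q (length b - 1) \<le> N" "N < q (length b)"
    if "is_ostrowski_rep \<xi> N b" for b
  proof -
    have N: "N = (\<Sum>i<length b. b ! i * q i)" and adm: "admissible (length b) ((!) b)"
      and last: "b \<noteq> [] \<Longrightarrow> last b \<noteq> 0"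
      using that by (auto simp: is_ostrowski_rep_iff_admissible)
    show "N < q (length b)" using admissible_sum_less[OF adm] N by simp
    show "q (length b - 1) \<le> N" if "b \<noteq> []"
    proof -
      have "b ! (length b - 1) * q (length b - 1) \<le> N"
        unfolding N by (rule member_le_sum) (use that in auto)
      moreover have "1 * q (length b - 1) \<le> b ! (length b - 1) * q (length b - 1)"
        using last[OF that] that by (intro mult_le_mono1) (simp add: last_conv_nth)
      ultimately show ?thesis by linarith
    qed
  qed
  have "\<not> length b < length b'"
    if "is_ostrowski_rep \<xi> N b" "is_ostrowski_rep \<xi> N b'" for b b'
  proof
    assume *: "length b < length b'"
    then have "q (length b) \<le> q (length b' - 1)"
      by (intro lift_Suc_mono_le[of q, OF convergent_denom_mono]) simp
    then show False using bounds(2)[OF that(1)] bounds(1)[OF that(2)] * by fastforce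
  qed
  then have len: "length b = length b'" using assms by (meson linorder_neqE_nat)
  show ?thesis
  proof (rule nth_equalityI[OF len])
    show "b ! i = b' ! i" if "i < length b" for i
      using admissible_digits_unique[of "length b" "(!) b" "(!) b'" i] assms len that
      by (simp add: is_ostrowski_rep_iff_admissible)
  qed
qed

text \<open>The greedy expansion. If the top digit is maximal, the rest is smaller than \<open>q k\<close>, so it has an
expansion with one digit less and the carry rule holds.\<close>

lemma admissible_digits_exist:
  "N < q k \<Longrightarrow> \<exists>d. admissible k d \<and> (\<forall>i\<ge>k. d i = 0) \<and> N = (\<Sum>i<k. d i * q i)"
proof (induction k arbitrary: N rule: induct_nat_012)
  case 0
  then show ?case by (intro exI[of _ "\<lambda>_. 0"]) (simp add: admissible_def)
next
  case 1
  then show ?case by (intro exI[of _ "\<lambda>i. if i = 0 then N else 0"]) (simp add: admissible_def)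
next
  case (ge2 k)
  define c where "c = N div q (Suc k)"
  define r where "r = N mod q (Suc k)"
  have N: "N = c * q (Suc k) + r" unfolding c_def r_def by (rule div_mult_mod_eq[symmetric])
  have r: "r < q (Suc k)" using convergent_denom_pos[of "Suc k"] by (simp add: r_def)
  have Nless: "N < a (Suc (Suc k)) * q (Suc k) + q k" using ge2.prems by simp
  have "c * q (Suc k) < Suc (a (Suc (Suc k))) * q (Suc k)"
    using Nless convergent_denom_mono[of k] unfolding N mult_Suc by linarith
  then have c: "c \<le> a (Suc (Suc k))" by (simp only: mult_less_cancel2 less_Suc_eq_le)
  have "\<exists>d. admissible (Suc k) d \<and> (\<forall>i\<ge>Suc k. d i = 0) \<and> r = (\<Sum>i<Suc k. d i * q i)
      \<and> (c = a (Suc (Suc k)) \<longrightarrow> d k = 0)"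
  proof (cases "c = a (Suc (Suc k))")
    case True
    then have "r < q k" using Nless N by simp
    then obtain d where "admissible k d" "\<forall>i\<ge>k. d i = 0" "r = (\<Sum>i<k. d i * q i)"
      using ge2.IH(1) by blast
    moreover have "admissible (Suc k) d"
      using calculation(1,2) partial_quotient_pos[of 0] partial_quotient_pos[of k]
      by (auto simp: admissible_def less_Suc_eq Suc_le_eq)
    ultimately show ?thesis by auto
  next
    case False
    then show ?thesis using ge2.IH(2)[OF r] by blast
  qed
  then obtain d where d: "admissible (Suc k) d" "\<forall>i\<ge>Suc k. d i = 0" "r = (\<Sum>i<Suc k. d i * q i)"
      "c = a (Suc (Suc k)) \<Longrightarrow> d k = 0" by blast
  have "admissible (Suc (Suc k)) (\<lambda>i. if i = Suc k then c else d i)"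
    using d(1,4) c unfolding admissible_def by (auto simp: less_Suc_eq)
  then show ?case
    using d(2,3) N by (intro exI[of _ "\<lambda>i. if i = Suc k then c else d i"]) auto
qed

text \<open>Taking the least \<open>k\<close> with \<open>N < q k\<close> makes the leading digit non-zero.\<close>

lemma ostrowski_rep_exists: "\<exists>b. is_ostrowski_rep \<xi> N b"
proof -
  have "\<exists>k. N < q k"
  proof -
    have "n \<le> q (2 * n)" for n
    proof (induction n)
      case (Suc n)
      have "Suc n \<le> 1 * q (Suc (2 * n)) + q (2 * n)"
        using Suc convergent_denom_pos[of "Suc (2 * n)"] by simp
      also have "\<dots> \<le> q (2 * Suc n)"
        using mult_le_mono1[OF partial_quotient_pos[of "Suc (2 * n)"], of "q (Suc (2 * n))"] by simp
      finally show ?case .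
    qed simp
    then show ?thesis by (meson Suc_le_eq)
  qed
  define k where "k = (LEAST k. N < q k)"
  have k: "N < q k" unfolding k_def using \<open>\<exists>k. N < q k\<close> by (rule LeastI_ex)
  obtain d where d: "admissible k d" "N = (\<Sum>i<k. d i * q i)"
    using admissible_digits_exist[OF k] by blast
  have "d (k - 1) \<noteq> 0" if "k > 0"
  proof
    assume "d (k - 1) = 0"
    then have "N = (\<Sum>i<k - 1. d i * q i)" using d(2) that by (cases k) simp_all
    moreover have "admissible (k - 1) d" using d(1) by (rule admissible_mono) simp
    ultimately have "N < q (k - 1)" using admissible_sum_less by simp
    then have "k \<le> k - 1" unfolding k_def by (rule Least_le)
    then show False using that by simp
  qed
  moreover have "admissible k ((!) (map d [0..<k]))"
    using d(1) admissible_cong[of k "(!) (map d [0..<k])" d] by simp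
  ultimately have "is_ostrowski_rep \<xi> N (map d [0..<k])"
    using d(2) by (simp add: is_ostrowski_rep_iff_admissible last_map)
  then show ?thesis ..
qed

lemma is_ostrowski_rep_iff: "is_ostrowski_rep \<xi> N b \<longleftrightarrow> ostrowski_rep \<xi> N = b"
  unfolding ostrowski_rep_def
  using ostrowski_rep_exists ostrowski_rep_unique by (metis the_equality)

end

section \<open>An automaton for the records\<close>

text \<open>The Myhill--Nerode construction: the states are the left quotients of \<open>L\<close>, numbered by an
injection into the natural numbers, and reading a letter passes to a further quotient.\<close>

lemma dfa_of_finitely_many_quotients:
  fixes L :: "nat list set"
  assumes "finite A" and fin: "finite ((\<lambda>w. {v. w @ v \<in> L}) ` lists A)"
  obtains M :: "(nat, nat) dfa" where
    "is_dfa M" "dfa_alphabet M = A" "\<And>w. dfa_accepts M w \<longleftrightarrow> w \<in> lists A \<and> w \<in> L"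
proof -
  define Q where "Q = (\<lambda>w. {v. w @ v \<in> L}) ` lists A"
  have "finite Q" unfolding Q_def by (rule fin)
  then obtain enc :: "nat list set \<Rightarrow> nat" where enc: "inj_on enc Q"
    using finite_imp_inj_to_nat_seg[of Q] by blast
  define \<delta> where "\<delta> = (\<lambda>s x. enc {v. x # v \<in> inv_into Q enc s})"
  define M :: "(nat, nat) dfa" where
    "M = \<lparr>dfa_states = enc ` Q, dfa_alphabet = A, dfa_init = enc L, dfa_trans = \<delta>,
          dfa_accepting = enc ` {X \<in> Q. [] \<in> X}\<rparr>"
  have quotient: "{v. w @ v \<in> L} \<in> Q" if "w \<in> lists A" for w
    using that by (simp add: Q_def)
  have step: "\<delta> (enc {v. w @ v \<in> L}) x = enc {v. (w @ [x]) @ v \<in> L}" if "w \<in> lists A" for w x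
    using inv_into_f_f[OF enc quotient[OF that]] by (simp add: \<delta>_def)
  have "enc L \<in> enc ` Q" using quotient[of "[]"] by simp
  moreover have "\<delta> s x \<in> enc ` Q" if s: "s \<in> enc ` Q" and x: "x \<in> A" for s x
  proof -
    obtain X where "X \<in> Q" "s = enc X" using s by blast
    then obtain w where w: "w \<in> lists A" "s = enc {v. w @ v \<in> L}"
      unfolding Q_def by (elim imageE) simp
    have "\<delta> s x = enc {v. (w @ [x]) @ v \<in> L}" unfolding w(2) by (rule step[OF w(1)])
    moreover have "{v. (w @ [x]) @ v \<in> L} \<in> Q" by (rule quotient) (use w x in simp)
    ultimately show ?thesis by (simp only: imageI)
  qed
  ultimately have "is_dfa M"
    using \<open>finite Q\<close> \<open>finite A\<close> by (simp add: is_dfa_def M_def image_mono)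
  have run: "foldl \<delta> (enc L) w = enc {v. w @ v \<in> L}" if "w \<in> lists A" for w
    using that
  proof (induction w rule: rev_induct)
    case (snoc x w)
    then show ?case using step[of w x] by simp
  qed simp
  have "dfa_accepts M w \<longleftrightarrow> w \<in> lists A \<and> w \<in> L" for w
  proof (cases "w \<in> lists A")
    case True
    have "foldl \<delta> (enc L) w \<in> enc ` {X \<in> Q. [] \<in> X} \<longleftrightarrow> {v. w @ v \<in> L} \<in> {X \<in> Q. [] \<in> X}"
      unfolding run[OF True] by (rule inj_on_image_mem_iff[OF enc quotient[OF True]]) blast
    then show ?thesis using True quotient[OF True] by (simp add: dfa_accepts_def M_def)
  qed (simp add: dfa_accepts_def M_def)
  then show thesis using that[of M] \<open>is_dfa M\<close> by (simp add: M_def)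
qed

definition descending_word :: "(nat \<Rightarrow> nat) \<Rightarrow> nat \<Rightarrow> nat list" where
  "descending_word d r = rev (map d [0..<r])"

lemma append_eq_descending_word_iff:
  "u @ v = descending_word d n \<longleftrightarrow>
     (\<exists>r. n = length u + r \<and> v = descending_word d r \<and> (\<forall>i<length u. u ! i = d (n - 1 - i)))"
proof -
  have "length u \<le> n" if "u = take (length u) (descending_word d n)"
    using arg_cong[OF that, of length] by (simp add: descending_word_def)
  then have "u @ v = descending_word d n \<longleftrightarrow>
      length u \<le> n \<and> u = take (length u) (descending_word d n) \<and> v = drop (length u) (descending_word d n)"
    unfolding append_eq_conv_conj by blast
  also have "\<dots> \<longleftrightarrow> length u \<le> n \<and> (\<forall>i<length u. u ! i = d (n - 1 - i))
      \<and> v = descending_word d (n - length u)"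
  proof (cases "length u \<le> n")
    case True
    have "drop (length u) (descending_word d n) = descending_word d (n - length u)"
      by (simp add: descending_word_def drop_rev take_map)
    moreover have "u = take (length u) (descending_word d n) \<longleftrightarrow>
        (\<forall>i<length u. u ! i = d (n - 1 - i))"
      using True by (auto simp: list_eq_iff_nth_eq descending_word_def rev_nth)
    ultimately show ?thesis by auto
  qed simp
  also have "\<dots> \<longleftrightarrow> (\<exists>r. n = length u + r \<and> v = descending_word d r
      \<and> (\<forall>i<length u. u ! i = d (n - 1 - i)))"
    by (auto simp: le_iff_add)
  finally show ?thesis .
qed

text \<open>The digit words of the records, most significant digit first, if \<open>d\<close> is the digit function
\<open>half_digit\<close> below; the empty word represents \<open>0\<close>.\<close>

definition half_digit_words :: "(nat \<Rightarrow> nat) \<Rightarrow> nat list set" where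
  "half_digit_words d = insert [] {c # descending_word d n | c n. even n \<and> 1 \<le> c \<and> c \<le> d n}"

text \<open>After a non-empty prefix \<open>c # u\<close> the rest of a word is determined by its length \<open>r\<close>, so the
quotient is described by the set \<open>F c u\<close> of lengths \<open>r\<close> at which the prefix fits. Membership of
\<open>r\<close> depends only on the parity of \<open>r\<close> and on the digits from position \<open>r\<close> upwards. Since \<open>d\<close> is
eventually periodic with an even period, \<open>F c u\<close> is determined by its part below \<open>K + T\<close>.\<close>

lemma finitely_many_quotients_half_digit_words:
  assumes periodic: "\<And>n. K \<le> n \<Longrightarrow> d (n + T) = d n" and "0 < T" "even T"
  shows "finite (range (\<lambda>w. {v. w @ v \<in> half_digit_words d}))"
proof -
  define F where "F = (\<lambda>c u. {r. even (length u + r) \<and> 1 \<le> c \<and> c \<le> d (length u + r)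
    \<and> (\<forall>i<length u. u ! i = d (length u + r - 1 - i))})"
  have quotient: "{v. (c # u) @ v \<in> half_digit_words d} = descending_word d ` F c u" for c u
    unfolding half_digit_words_def F_def by (auto simp: append_eq_descending_word_iff)
  \<comment> \<open>The representative of \<open>r\<close> in the preperiod or the first period.\<close>
  define \<rho> where "\<rho> = (\<lambda>r. if r < K then r else K + (r - K) mod T)"
  have periodic_mult: "d (n + k * T) = d n" if "K \<le> n" for n k
  proof (induction k)
    case (Suc k)
    have "d (n + Suc k * T) = d (n + k * T + T)" by (simp add: ac_simps)
    also have "\<dots> = d n" using periodic[of "n + k * T"] that Suc by simp
    finally show ?case .
  qed simp
  have \<rho>: "r \<in> F c u \<longleftrightarrow> \<rho> r \<in> F c u" for r c u
  proof (cases "r < K")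
    case False
    define k where "k = (r - K) div T"
    have r: "r = \<rho> r + k * T"
      using False div_mult_mod_eq[of "r - K" T] unfolding \<rho>_def k_def by simp
    have "K \<le> \<rho> r" using False by (simp add: \<rho>_def)
    have shift: "d (j + r) = d (j + \<rho> r)" for j
      using periodic_mult[of "j + \<rho> r" k] \<open>K \<le> \<rho> r\<close> r by (simp add: add.assoc)
    have "even r \<longleftrightarrow> even (\<rho> r)" by (subst (1) r) (simp add: \<open>even T\<close>)
    then have par: "even (length u + r) \<longleftrightarrow> even (length u + \<rho> r)" by simp
    have "d (length u + r - 1 - i) = d (length u + \<rho> r - 1 - i)" if "i < length u" for i
    proof -
      have "length u + x - 1 - i = (length u - 1 - i) + x" for x using that by simp
      then show ?thesis using shift by simp
    qed
    then show ?thesis unfolding F_def using shift par by auto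
  qed (simp add: \<rho>_def)
  have "{v. w @ v \<in> half_digit_words d}
      \<in> insert (half_digit_words d) ((\<lambda>G. descending_word d ` {r. \<rho> r \<in> G}) ` Pow {..<K + T})" for w
  proof (cases w)
    case (Cons c u)
    have "\<rho> r < K + T" for r using \<open>0 < T\<close> by (simp add: \<rho>_def)
    then have "F c u = {r. \<rho> r \<in> F c u \<inter> {..<K + T}}" using \<rho>[of _ c u] by auto
    then show ?thesis unfolding Cons quotient by blast
  qed simp
  then have "range (\<lambda>w. {v. w @ v \<in> half_digit_words d})
      \<subseteq> insert (half_digit_words d) ((\<lambda>G. descending_word d ` {r. \<rho> r \<in> G}) ` Pow {..<K + T})"
    by blast
  then show ?thesis by (rule finite_subset) simp
qed

context BR_walk
begin

definition half_digit :: "nat \<Rightarrow> nat" where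
  "half_digit i = (if even i then a (Suc i) div 2 else 0)"

lemma half_digit_even [simp]: "half_digit (2 * m) = half m"
  by (simp add: half_digit_def half_def)

lemma sum_half_digit: "(\<Sum>i<2 * m. half_digit i * q i) = level_time m"
proof (induction m)
  case (Suc m)
  then show ?case by (simp add: level_time_def) (simp add: half_digit_def)
qed simp

text \<open>The digits lie strictly below their upper bounds because the partial quotients are positive; this
settles both kinds of digit conditions at once.\<close>

lemma record_ostrowski_rep:
  assumes "1 \<le> c" "c \<le> half m"
  shows "is_ostrowski_rep \<xi> (level_time m + c * q (2 * m)) (map half_digit [0..<2 * m] @ [c])"
proof -
  let ?b = "map half_digit [0..<2 * m] @ [c]"
  have less: "half k < a (Suc (2 * k))" for k
    using half_pos[of k] double_half[of k] by simp
  have digit: "?b ! i < a (Suc i)" if "i < Suc (2 * m)" for i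
  proof (cases "i = 2 * m")
    case True
    then show ?thesis using less[of m] assms by (simp add: nth_append)
  next
    case False
    then have "?b ! i = half_digit i" using that by (simp add: nth_append)
    moreover have "half_digit i < a (Suc i)"
      using partial_quotient_pos[of i] less[of "i div 2"] by (cases "even i") (auto simp: half_digit_def)
    ultimately show ?thesis by simp
  qed
  have "admissible (length ?b) ((!) ?b)"
    unfolding admissible_def
  proof (intro conjI impI allI)
    fix i assume i: "1 \<le> i \<and> i < length ?b"
    have less: "?b ! i < a (i + 1)" using digit[of i] i by simp
    then show "?b ! i \<le> a (i + 1)" by (rule less_imp_le)
    show "?b ! (i - 1) = 0" if "?b ! i = a (i + 1)" using less unfolding that by simp
  qed (use digit[of 0] in simp)
  moreover have "(\<Sum>i<length ?b. ?b ! i * q i) = level_time m + c * q (2 * m)"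
  proof -
    have "(\<Sum>i<length ?b. ?b ! i * q i) = (\<Sum>i<2 * m. ?b ! i * q i) + ?b ! (2 * m) * q (2 * m)" by simp
    also have "(\<Sum>i<2 * m. ?b ! i * q i) = (\<Sum>i<2 * m. half_digit i * q i)"
      by (intro sum.cong) (simp_all add: nth_append)
    finally show ?thesis by (simp add: sum_half_digit nth_append)
  qed
  ultimately show ?thesis
    using assms by (simp add: is_ostrowski_rep_iff_admissible)
qed

lemma level_decomposition_pos:
  assumes "0 < v"
  obtains m c where "v = level_height m + c" "1 \<le> c" "c \<le> half m"
proof -
  obtain m c where "v - 1 = level_height m + c" "c < half m" by (rule level_decomposition)
  then show thesis using that[of m "Suc c"] assms by simp
qed

lemma record_iff_half_digit_word:
  "N \<in> records (walk (2 * \<xi>)) \<longleftrightarrow> rev (ostrowski_rep \<xi> N) \<in> half_digit_words half_digit"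
proof -
  have zero: "ostrowski_rep \<xi> 0 = []"
    by (simp flip: is_ostrowski_rep_iff) (simp add: is_ostrowski_rep_def)
  have rep: "rev (ostrowski_rep \<xi> (level_time m + c * q (2 * m))) = c # descending_word half_digit (2 * m)"
    if "1 \<le> c" "c \<le> half m" for m c
    using record_ostrowski_rep[OF that] by (simp add: is_ostrowski_rep_iff descending_word_def)
  show ?thesis
  proof
    assume "N \<in> records (walk (2 * \<xi>))"
    then obtain v where N: "N = first_hit v" by (auto simp: records_eq_range_first_hit)
    show "rev (ostrowski_rep \<xi> N) \<in> half_digit_words half_digit"
    proof (cases "v = 0")
      case True
      then show ?thesis using first_hit_level[of 0 0] N zero by (simp add: half_digit_words_def)
    next
      case False
      then obtain m c where v: "v = level_height m + c" "1 \<le> c" "c \<le> half m"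
        using level_decomposition_pos by auto
      then have "rev (ostrowski_rep \<xi> N) = c # descending_word half_digit (2 * m)"
        using rep first_hit_level N by simp
      moreover have "even (2 * m)" "c \<le> half_digit (2 * m)" using v by simp_all
      ultimately show ?thesis using v(2) unfolding half_digit_words_def by blast
    qed
  next
    assume "rev (ostrowski_rep \<xi> N) \<in> half_digit_words half_digit"
    then consider "rev (ostrowski_rep \<xi> N) = []" | c n where
        "rev (ostrowski_rep \<xi> N) = c # descending_word half_digit n"
        "even n" "1 \<le> c" "c \<le> half_digit n"
      unfolding half_digit_words_def by blast
    then have "\<exists>v. N = first_hit v"
    proof cases
      case 1
      then have "is_ostrowski_rep \<xi> N []" by (simp add: is_ostrowski_rep_iff)
      then have "N = 0" by (simp add: is_ostrowski_rep_def)
      then show ?thesis using first_hit_level[of 0 0] by (intro exI[of _ 0]) simp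
    next
      case 2
      then obtain m where m: "n = 2 * m" by (auto elim: evenE)
      then have c: "1 \<le> c" "c \<le> half m" using 2 by simp_all
      have "rev (ostrowski_rep \<xi> N) = rev (ostrowski_rep \<xi> (level_time m + c * q (2 * m)))"
        using 2(1) rep[OF c] m by simp
      then have eq: "ostrowski_rep \<xi> N = ostrowski_rep \<xi> (level_time m + c * q (2 * m))" by simp
      have "is_ostrowski_rep \<xi> N (ostrowski_rep \<xi> N)"
        "is_ostrowski_rep \<xi> (level_time m + c * q (2 * m)) (ostrowski_rep \<xi> N)"
        using eq by (simp_all add: is_ostrowski_rep_iff)
      then have "N = level_time m + c * q (2 * m)"
        unfolding is_ostrowski_rep_def by (metis (no_types, lifting))
      then show ?thesis using first_hit_level[OF c(2)] by metis
    qed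
    then show "N \<in> records (walk (2 * \<xi>))" by (auto simp: records_eq_range_first_hit)
  qed
qed

lemma ostrowski_digit_le:
  assumes "is_ostrowski_rep \<xi> N b" "x \<in> set b"
  shows "\<exists>i. x \<le> a (Suc i)"
proof -
  obtain i where i: "i < length b" "x = b ! i" using assms(2) by (metis in_set_conv_nth)
  have "b ! i \<le> a (Suc i)"
  proof (cases "i = 0")
    case True
    have "b \<noteq> []" using assms(2) by auto
    then have "b ! 0 < a 1" using assms(1) unfolding is_ostrowski_rep_def by blast
    then show ?thesis using True by simp
  next
    case False
    then have "1 \<le> i" by simp
    then have "b ! i \<le> a (i + 1)" using assms(1) i(1) unfolding is_ostrowski_rep_def by blast
    then show ?thesis by simp
  qed
  then show ?thesis using i(2) by blast
qed

text \<open>The period is doubled because the digits also depend on the parity of their position.\<close>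

lemma records_ostrowski_automatic:
  assumes "0 < T" and periodic: "\<And>n. N\<^sub>0 \<le> n \<Longrightarrow> a (n + T) = a n"
  shows "ostrowski_automatic \<xi> (records (walk (2 * \<xi>)))"
proof -
  have "half_digit (n + 2 * T) = half_digit n" if "N\<^sub>0 \<le> n" for n
    using periodic[of "Suc n"] periodic[of "Suc n + T"] that
    by (simp add: half_digit_def mult_2 add.assoc)
  then have "finite (range (\<lambda>w. {v. w @ v \<in> half_digit_words half_digit}))"
    by (rule finitely_many_quotients_half_digit_words) (use \<open>0 < T\<close> in simp_all)
  then have quotients: "finite ((\<lambda>w. {v. w @ v \<in> half_digit_words half_digit}) ` lists A)" for A
    by (rule finite_subset[rotated]) blast
  have "range a = a ` {..<N\<^sub>0 + T}"
  proof -
    have "a n \<in> a ` {..<N\<^sub>0 + T}" for n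
    proof (induction n rule: less_induct)
      case (less n)
      show ?case
      proof (cases "n < N\<^sub>0 + T")
        case False
        then have "a n = a (n - T)" using periodic[of "n - T"] by simp
        then show ?thesis using less[of "n - T"] False \<open>0 < T\<close> by simp
      qed simp
    qed
    then show ?thesis by blast
  qed
  then have "finite (range a)" by simp
  define A where "A = {..Max (range a)}"
  have word: "rev (ostrowski_rep \<xi> N) \<in> lists A" for N
  proof -
    have "x \<in> A" if x: "x \<in> set (ostrowski_rep \<xi> N)" for x
    proof -
      have "is_ostrowski_rep \<xi> N (ostrowski_rep \<xi> N)" by (simp add: is_ostrowski_rep_iff)
      then obtain i where "x \<le> a (Suc i)" using ostrowski_digit_le[OF _ x] by blast
      also have "\<dots> \<le> Max (range a)" using \<open>finite (range a)\<close> by (intro Max_ge) auto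
      finally show ?thesis by (simp add: A_def)
    qed
    then show ?thesis by (auto simp: in_lists_conv_set)
  qed
  obtain M :: "(nat, nat) dfa" where "is_dfa M" "dfa_alphabet M = A"
    "\<And>w. dfa_accepts M w \<longleftrightarrow> w \<in> lists A \<and> w \<in> half_digit_words half_digit"
    using dfa_of_finitely_many_quotients[of A, OF _ quotients] unfolding A_def by blast
  then have "is_dfa M \<and> (\<forall>N. rev (ostrowski_rep \<xi> N) \<in> lists (dfa_alphabet M) \<and>
      (dfa_accepts M (rev (ostrowski_rep \<xi> N)) \<longleftrightarrow> N \<in> records (walk (2 * \<xi>))))"
    using word by (simp add: record_iff_half_digit_word)
  then show ?thesis unfolding ostrowski_automatic_def by blast
qed

end

section \<open>Linear recurrences from periodic partial quotients\<close>

text \<open>The matrix \<open>(x y; x' y')\<close> that transports initial values over \<open>T\<close> steps does not depend on the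
solution; it can therefore be applied to a solution and to its shifts.\<close>

lemma periodic_recurrence_monodromy:
  fixes b :: "nat \<Rightarrow> int" and T :: nat
  obtains x y x' y' :: int where
    "\<And>u. (\<And>n. u (Suc (Suc n)) = b n * u (Suc n) + u n) \<Longrightarrow>
       u T = x * u 0 + y * u (Suc 0) \<and> u (Suc T) = x' * u 0 + y' * u (Suc 0)"
proof -
  let ?solution = "\<lambda>u. \<forall>n. u (Suc (Suc n)) = b n * u (Suc n) + u n"
  have "\<exists>x y. \<forall>u. ?solution u \<longrightarrow> u k = x * u 0 + y * u (Suc 0)" for k
  proof (induction k rule: induct_nat_012)
    case 0
    show ?case by (intro exI[of _ 1] exI[of _ 0]) simp
  next
    case 1
    show ?case by (intro exI[of _ 0] exI[of _ 1]) simp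
  next
    case (ge2 k)
    then obtain x y x' y'
      where IH: "?solution u \<Longrightarrow> u k = x * u 0 + y * u (Suc 0)"
        "?solution u \<Longrightarrow> u (Suc k) = x' * u 0 + y' * u (Suc 0)" for u
      by blast
    have "u (Suc (Suc k)) = (b k * x' + x) * u 0 + (b k * y' + y) * u (Suc 0)"
      if "?solution u" for u
    proof -
      have "u (Suc (Suc k)) = b k * u (Suc k) + u k" using that by blast
      then show ?thesis unfolding IH[OF that] by (simp add: algebra_simps)
    qed
    then show ?case by blast
  qed
  from this[of T] this[of "Suc T"] show thesis using that by metis
qed

text \<open>Shifting by one period maps solutions to solutions, and on initial values it acts by the
monodromy matrix. The Cayley--Hamilton theorem for this matrix gives the recurrence at the first two
indices with \<open>\<tau>\<close> the trace and \<open>-\<sigma>\<close> the determinant, and the defining recursion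
propagates it.\<close>

lemma periodic_recurrence_constant_coefficients:
  fixes u b :: "nat \<Rightarrow> int"
  assumes rec: "\<And>n. u (Suc (Suc n)) = b n * u (Suc n) + u n"
    and periodic: "\<And>n. b (n + T) = b n"
  obtains \<tau> \<sigma> :: int where "\<And>n. u (n + 2 * T) = \<tau> * u (n + T) + \<sigma> * u n"
proof -
  obtain x y x' y' :: int where mono:
    "\<And>u. (\<And>n. u (Suc (Suc n)) = b n * u (Suc n) + u n) \<Longrightarrow>
       u T = x * u 0 + y * u (Suc 0) \<and> u (Suc T) = x' * u 0 + y' * u (Suc 0)"
    using periodic_recurrence_monodromy by blast
  have shift: "u (Suc (Suc (n + T))) = b n * u (Suc (n + T)) + u (n + T)" for n
    using rec[of "n + T"] by (simp add: periodic)
  have M1: "u T = x * u 0 + y * u (Suc 0)" "u (Suc T) = x' * u 0 + y' * u (Suc 0)"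
    using mono[of u] rec by blast+
  have M2: "u (2 * T) = x * u T + y * u (Suc T)" "u (Suc (2 * T)) = x' * u T + y' * u (Suc T)"
    using mono[of "\<lambda>n. u (n + T)"] shift by (simp_all add: mult_2)
  define \<tau> \<sigma> where "\<tau> = x + y'" and "\<sigma> = y * x' - x * y'"
  have "u (n + 2 * T) = \<tau> * u (n + T) + \<sigma> * u n" for n
  proof (induction n rule: induct_nat_012)
    case 0
    show ?case unfolding add_0 M2 \<tau>_def \<sigma>_def M1 by algebra
  next
    case 1
    have "u (Suc (2 * T)) = \<tau> * u (Suc T) + \<sigma> * u (Suc 0)"
      unfolding M2 \<tau>_def \<sigma>_def M1 by algebra
    then show ?case by simp
  next
    case (ge2 n)
    have "b (n + 2 * T) = b n" using periodic[of "n + T"] periodic[of n] by (simp add: mult_2 add.assoc)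
    then have "u (Suc (Suc n) + 2 * T) = b n * u (Suc n + 2 * T) + u (n + 2 * T)"
      using rec[of "n + 2 * T"] by simp
    also have "\<dots> = \<tau> * u (Suc (Suc n) + T) + \<sigma> * u (Suc (Suc n))"
      using ge2 rec[of n] shift[of n] by (simp add: algebra_simps)
    finally show ?case .
  qed
  then show thesis using that by blast
qed

context BR_walk
begin

lemma double_level_time: "2 * level_time (Suc m) = q (Suc (2 * m))"
  using double_half_denom by (simp add: level_time_Suc)

lemma level_height_mono: "m \<le> n \<Longrightarrow> level_height m \<le> level_height n"
  by (rule lift_Suc_mono_le) simp_all

text \<open>Over one period of the partial quotients the levels rise by a constant height \<open>H\<close>. So \<open>v\<close>,
\<open>v + H\<close> and \<open>v + 2 * H\<close> have the same position \<open>c\<close> on corresponding levels, and the first hits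
of all three are the same combination \<open>q (2m-1) / 2 + c * q (2m)\<close> of denominators.\<close>

lemma first_hit_recurrence:
  assumes "0 < T" and periodic: "\<And>n. N \<le> n \<Longrightarrow> a (n + T) = a n"
  obtains H v\<^sub>0 :: nat and \<tau> \<sigma> :: int where "0 < H"
    "\<And>v. v\<^sub>0 \<le> v \<Longrightarrow>
       int (first_hit (v + 2 * H)) = \<tau> * int (first_hit (v + H)) + \<sigma> * int (first_hit v)"
proof -
  have periodic2: "a (n + 2 * T) = a n" if "N \<le> n" for n
    using periodic[OF that] periodic[of "n + T"] that by (simp add: mult_2 add.assoc)
  have "int (q (Suc (Suc n) + N)) = int (a (Suc (Suc (n + N)))) * int (q (Suc n + N)) + int (q (n + N))" for n
    by simp
  moreover have "int (a (Suc (Suc (n + 2 * T + N)))) = int (a (Suc (Suc (n + N))))" for n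
    using periodic2[of "Suc (Suc (n + N))"] by (simp add: ac_simps)
  ultimately obtain \<tau> \<sigma> where
    rec: "int (q (n + 2 * (2 * T) + N)) = \<tau> * int (q (n + 2 * T + N)) + \<sigma> * int (q (n + N))" for n
    using periodic_recurrence_constant_coefficients
        [of "\<lambda>n. int (q (n + N))" "\<lambda>n. int (a (Suc (Suc (n + N))))" "2 * T"] by blast
  have q_rec: "int (q (n + 4 * T)) = \<tau> * int (q (n + 2 * T)) + \<sigma> * int (q n)" if "N \<le> n" for n
  proof -
    have "n - N + 2 * (2 * T) + N = n + 4 * T" "n - N + 2 * T + N = n + 2 * T" "n - N + N = n"
      using that by simp_all
    then show ?thesis using rec[of "n - N"] by (simp only:)
  qed
  \<comment> \<open>Levels from \<open>M\<close> on are periodic, and \<open>M > 0\<close> ensures that \<open>q (2m-1)\<close> exists.\<close>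
  define M where "M = Suc N"
  define H where "H = level_height (M + T) - level_height M"
  have half: "half (m + T) = half m" if "M \<le> m" for m
    using periodic2[of "Suc (2 * m)"] that by (simp add: half_def M_def algebra_simps)
  have H: "level_height (m + T) = level_height m + H" if "M \<le> m" for m
    using that
  proof (induction m rule: dec_induct)
    case base
    show ?case using level_height_mono[of M "M + T"] by (simp add: H_def)
  next
    case (step m)
    then show ?case using half[of m] by simp
  qed
  have "level_height M < level_height (Suc M)" using half_pos[of M] by simp
  also have "\<dots> \<le> level_height (M + T)" using \<open>0 < T\<close> by (intro level_height_mono) simp
  finally have "0 < H" by (simp add: H_def)
  have "int (first_hit (v + 2 * H)) = \<tau> * int (first_hit (v + H)) + \<sigma> * int (first_hit v)"
    if "level_height M \<le> v" for v
  proof -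
    obtain m c where v: "v = level_height m + c" and c: "c < half m"
      by (rule level_decomposition)
    have "M \<le> m"
    proof (rule ccontr)
      assume "\<not> M \<le> m"
      then have "level_height (Suc m) \<le> level_height M" by (intro level_height_mono) simp
      then show False using that v c by simp
    qed
    then obtain l where l: "m = Suc l" "N \<le> l" by (cases m) (auto simp: M_def)
    have vH: "v + H = level_height (m + T) + c" and v2H: "v + 2 * H = level_height (m + 2 * T) + c"
      using v H[OF \<open>M \<le> m\<close>] H[of "m + T"] \<open>M \<le> m\<close> by (simp_all add: mult_2 add.assoc)
    have halves: "half (m + T) = half m" "half (m + 2 * T) = half m"
      using half[OF \<open>M \<le> m\<close>] half[of "m + T"] \<open>M \<le> m\<close> by (simp_all add: mult_2 add.assoc)
    have hits: "first_hit v = level_time m + c * q (2 * m)"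
      "first_hit (v + H) = level_time (m + T) + c * q (2 * (m + T))"
      "first_hit (v + 2 * H) = level_time (m + 2 * T) + c * q (2 * (m + 2 * T))"
      unfolding vH v2H unfolding v using c halves by (simp_all only: first_hit_level less_imp_le)
    have "2 * level_time m = q (Suc (2 * l))"
      "2 * level_time (m + T) = q (Suc (2 * l) + 2 * T)"
      "2 * level_time (m + 2 * T) = q (Suc (2 * l) + 4 * T)"
      using double_level_time[of l] double_level_time[of "l + T"] double_level_time[of "l + 2 * T"]
      by (simp_all add: l del: convergent_denom.simps)
    then have "int (2 * level_time (m + 2 * T)) =
        \<tau> * int (2 * level_time (m + T)) + \<sigma> * int (2 * level_time m)"
      using q_rec[of "Suc (2 * l)"] l(2) by (simp only:)
    then have "2 * int (level_time (m + 2 * T)) =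
        2 * (\<tau> * int (level_time (m + T)) + \<sigma> * int (level_time m))"
      by (simp add: algebra_simps)
    then have "int (level_time (m + 2 * T)) =
        \<tau> * int (level_time (m + T)) + \<sigma> * int (level_time m)"
      by (simp add: algebra_simps)
    moreover have "int (q (2 * (m + 2 * T))) = \<tau> * int (q (2 * (m + T))) + \<sigma> * int (q (2 * m))"
      using q_rec[of "2 * m"] l by (simp add: algebra_simps del: convergent_denom.simps)
    ultimately show ?thesis unfolding hits by (simp add: algebra_simps)
  qed
  then show thesis using that \<open>0 < H\<close> by blast
qed

text \<open>A single residue class is enough: the recurrence with gaps \<open>H\<close> and \<open>2 * H\<close> holds along all
large indices.\<close>

lemma records_linear_recurrence:
  assumes "0 < T" "\<And>n. N \<le> n \<Longrightarrow> a (n + T) = a n"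
  shows "satisfies_linear_recurrence_system (\<lambda>n. int (enumerate (records (walk (2 * \<xi>))) n))"
proof -
  obtain H v\<^sub>0 :: nat and \<tau> \<sigma> :: int where "0 < H" and rec:
    "\<And>v. v\<^sub>0 \<le> v \<Longrightarrow>
       int (first_hit (v + 2 * H)) = \<tau> * int (first_hit (v + H)) + \<sigma> * int (first_hit v)"
    using first_hit_recurrence[OF assms] by blast
  define c where "c = (\<lambda>(i::nat) l. if l = H then \<tau> else if l = 2 * H then \<sigma> else 0)"
  have "int (first_hit n) = (\<Sum>l = 1..2 * H. c 0 l * int (first_hit (n - l)))"
    if "v\<^sub>0 + 2 * H \<le> n" for n
  proof -
    have "(\<Sum>l = 1..2 * H. c 0 l * int (first_hit (n - l)))
        = (\<Sum>l\<in>{H, 2 * H}. c 0 l * int (first_hit (n - l)))"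
      using \<open>0 < H\<close> by (intro sum.mono_neutral_right) (auto simp: c_def)
    also have "\<dots> = \<tau> * int (first_hit (n - H)) + \<sigma> * int (first_hit (n - 2 * H))"
      using \<open>0 < H\<close> by (simp add: c_def)
    also have "\<dots> = int (first_hit n)"
    proof -
      have "n - 2 * H + 2 * H = n" "n - 2 * H + H = n - H" using that by simp_all
      then show ?thesis using rec[of "n - 2 * H"] that by simp
    qed
    finally show ?thesis by simp
  qed
  then have "\<forall>\<^sub>F n in sequentially.
      int (first_hit n) = (\<Sum>l = 1..2 * H. c 0 l * int (first_hit (n - l)))"
    by (auto simp: eventually_sequentially)
  then show ?thesis
    unfolding satisfies_linear_recurrence_system_def enumerate_records
    using \<open>0 < H\<close>
    by (intro exI[of _ 1] exI[of _ "2 * H"] exI[of _ c] exI[of _ "\<lambda>_. 0"]) simp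
qed

end

theorem corollary12:
  fixes \<xi> :: real
  assumes "quadratic_irrational \<xi>" and "BR_number \<xi>"
  shows "ostrowski_automatic \<xi> (records (walk (2 * \<xi>))) \<and>
    infinite (records (walk (2 * \<xi>))) \<and>
    satisfies_linear_recurrence_system (\<lambda>n. int (enumerate (records (walk (2 * \<xi>))) n))"
proof -
  interpret BR_walk \<xi> by unfold_locales (rule assms(2))
  obtain N T where "0 < T" and periodic: "\<And>n. N \<le> n \<Longrightarrow> a (n + T) = a n"
    by (rule partial_quotients_eventually_periodic[OF assms(1)]) blast
  show ?thesis
    using records_ostrowski_automatic[OF \<open>0 < T\<close> periodic] infinite_records
      records_linear_recurrence[OF \<open>0 < T\<close> periodic] by blast
qed

end
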